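(* Let $0<q<1$, let $r$ be a positive integer, and let $m,n$ be either both non-negative integers or both positive half-integers. Then $$\sum_{k_1,\dots,k_r=-n}^n\ \prod_{1\le i<j\le r}[k_j-k_i]_q^2\ \prod_{i=1}^r q^{k_i^2+(m+n-2i+2)k_i}\begin{bmatrix}2n\\ n+k_i\end{bmatrix}_q\begin{bmatrix}2m\\ m+k_i\end{bmatrix}_q$$ $$=r!\,q^{-rmn-\frac16 r(r-1)(2r-3m-3n-1)}\prod_{i=1}^r\frac{\Gamma_q(i)\,\Gamma_q(2n+1)\,\Gamma_q(2m+1)\,\Gamma_q(2m+2n-r-i+3)}{\Gamma_q(2n-i+2)\,\Gamma_q(2m-i+2)\,\Gamma_q(m+n-i+2)^2}.$$
   Context: Each $k_i$ runs over $\{-n,-n+1,\dots,n\}$ (half-integers, i.e. elements of $\frac12+\mathbb{Z}$, if $n$ is a half-integer). Notation: $(a;q)_\infty=\prod_{k\ge1}(1-aq^{k-1})$; $(a;q)_k=\prod_{j=1}^k(1-aq^{j-1})$; $\begin{bmatrix}N\\ M\end{bmatrix}_q=\frac{(q;q)_N}{(q;q)_M(q;q)_{N-M}}$ for integers $0\le M\le N$, and $0$ for integers $M<0$ or $M>N$; $[x]_q=\frac{1-q^x}{1-q}$; $\Gamma_q(x)=(1-q)^{1-x}\frac{(q;q)_\infty}{(q^x;q)_\infty}$, so $1/\Gamma_q(x)=0$ for $x\in\{0,-1,-2,\dots\}$. If a numerator factor on the right-hand side has a pole, the right-hand side is understood as its limiting value when $m,n$ are replaced by $m+\varepsilon,n+\varepsilon$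 and $\varepsilon\to0$. *)

theory Defs
  imports "HOL-Analysis.Analysis"
begin

definition qpoch_inf :: "real \<Rightarrow> real \<Rightarrow> real" where
  "qpoch_inf a q = (\<Prod>k. 1 - a * q ^ k)"

definition qpoch :: "real \<Rightarrow> real \<Rightarrow> nat \<Rightarrow> real" where
  "qpoch a q k = (\<Prod>j=1..k. 1 - a * q ^ (j - 1))"

definition qbinomial :: "real \<Rightarrow> int \<Rightarrow> int \<Rightarrow> real" where
  "qbinomial q N M =
     (if 0 \<le> M \<and> M \<le> N
      then qpoch q q (nat N) / (qpoch q q (nat M) * qpoch q q (nat (N - M)))
      else 0)"

definition qnumber :: "real \<Rightarrow> real \<Rightarrow> real" where
  "qnumber q x = (1 - q powr x) / (1 - q)"

(* At a pole x = 0, -1, -2, ... the infinite product in the denominator vanishes, so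
   Gamma_q q x = 0 since division by zero yields 0. In a denominator this gives
   the convention 1 / Gamma_q(x) = 0. In a numerator the value at a pole is
   meaningless and has to be excluded; see rhs_has_pole. *)
definition Gamma_q :: "real \<Rightarrow> real \<Rightarrow> real" where
  "Gamma_q q x = (1 - q) powr (1 - x) * qpoch_inf q q / qpoch_inf (q powr x) q"

(* The set {-n, -n+1, ..., n}, for n a non-negative integer or half-integer. *)
definition sum_range :: "real \<Rightarrow> real set" where
  "sum_range n = {k. - n \<le> k \<and> k \<le> n \<and> k - n \<in> \<int>}"

(* The closed form as an expression in arbitrary real m, n, so that m and n can be perturbed. *)
definition rhs :: "real \<Rightarrow> nat \<Rightarrow> real \<Rightarrow> real \<Rightarrow> real" where
  "rhs q r m n =
     fact r * q powr (- real r * m * n - real r * (real r - 1) * (2 * real r - 3 * m - 3 * n - 1) / 6)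
     * (\<Prod>i=1..r.
          Gamma_q q (real i) * Gamma_q q (2 * n + 1) * Gamma_q q (2 * m + 1)
            * Gamma_q q (2 * m + 2 * n - real r - real i + 3)
          / (Gamma_q q (2 * n - real i + 2) * Gamma_q q (2 * m - real i + 2)
            * (Gamma_q q (m + n - real i + 2))\<^sup>2))"

(* Some Gamma factor in a numerator of rhs is evaluated at a pole. *)
definition rhs_has_pole :: "nat \<Rightarrow> real \<Rightarrow> real \<Rightarrow> bool" where
  "rhs_has_pole r m n \<longleftrightarrow>
     (\<exists>i\<in>{1..r}. \<exists>x\<in>{real i, 2 * n + 1, 2 * m + 1, 2 * m + 2 * n - real r - real i + 3}.
        x \<in> nonpos_Ints)"

end

theory Submission
  imports Defs "Jordan_Normal_Form.Determinant"
begin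

text \<open>
  Write \<open>N = 2n\<close>, \<open>M = 2m\<close>, \<open>s = m + n\<close> and \<open>y\<^sub>i = q\<^bsup>n + k\<^sub>i\<^esup>\<close>.  The factor \<open>q\<^bsup>-2 i k\<^sub>i\<^esup>\<close>,
  which destroys the symmetry of the summand, is exactly what turns
  \<open>\<Prod> [k\<^sub>j - k\<^sub>i]\<^sup>2\<close> into the squared Vandermonde product of the \<open>y\<^sub>i\<close>
  (lemma \<open>summand_eq_vandermonde\<close>).  The sum is therefore a discrete Selberg-type sum
  \<open>\<Sum> V(y)\<^sup>2 \<Prod> w(k\<^sub>i)\<close>, and by the Andreief identity (\<open>andreief\<close>) it equals \<open>r!\<close> times a determinant
  of moments, for any two bases of the polynomials of degree less than \<open>r\<close>, up to the base
  change determinants.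

  The point is the choice of the bases.  All basis elements have full degree \<open>r - 1\<close>: each is a
  product of \<open>b\<close> factors that lower the argument of a \<open>q\<close>-binomial coefficient and of \<open>r - 1 - b\<close>
  factors that lower its complement (\<open>basis_poly\<close>).  Multiplying a weight by such a polynomial
  gives again a \<open>q\<close>-binomial coefficient, with upper entry smaller by \<open>r - 1\<close>
  (\<open>basis_poly_qbinomial\<close>).  With full degree on both sides the powers of \<open>q\<close> are those of the
  \<open>q\<close>-Vandermonde convolution, so that the moment with indices \<open>a\<close>, \<open>b\<close> is
  a power of \<open>q\<close> times \<open>[2L, L + a - b]\<close> with \<open>L = s - r + 1\<close>, up to a factor independent of \<open>a\<close>
  and \<open>b\<close> (\<open>moment\<close>).

  Three determinants remain: the two base changes and that of the moments.  All three are
  instances of one evaluation (\<open>det_basis_poly\<close>), since up to row factors \<open>[2L, L + a - b]\<close> is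
  itself the value at \<open>q\<^sup>a\<close> of a basis polynomial.  The evaluation holds because the determinant
  of values of a polynomial family is a constant times the Vandermonde product, and the constant
  can be read off at the nodes \<open>q\<^bsup>i - c\<^esup>\<close>, where the matrix is triangular.

  This covers \<open>r \<le> 2n + 1\<close> and \<open>r \<le> 2m + 1\<close>.  If one of these fails, the left-hand side vanishes:
  \<open>r\<close> distinct \<open>k\<^sub>i\<close> cannot all lie in \<open>[-n, n]\<close> and in \<open>[-m, m]\<close>.  On the right-hand side
  \<open>1 / \<Gamma>\<^sub>q\<close> then supplies a zero.  A numerator pole occurs only if \<open>r \<ge> m + n + 2\<close>, and comparing
  orders in \<open>\<epsilon>\<close> shows that the zeros outnumber the poles, so that the limit is \<open>0\<close>
  (\<open>rhs_tendsto_0\<close>).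
\<close>

section \<open>Determinants of polynomial families\<close>

definition vandermonde :: "nat \<Rightarrow> (nat \<Rightarrow> 'a::comm_ring_1) \<Rightarrow> 'a" where
  "vandermonde r x = (\<Prod>j<r. \<Prod>i<j. x j - x i)"

lemma det_triangular_fun:
  fixes f :: "nat \<Rightarrow> nat \<Rightarrow> 'a::comm_ring_1"
  assumes "\<And>i b. i < b \<Longrightarrow> b < r \<Longrightarrow> f i b = 0"
  shows "Determinant.det (Matrix.mat r r (\<lambda>(i, b). f i b)) = (\<Prod>i<r. f i i)"
proof -
  have "Determinant.det (Matrix.mat r r (\<lambda>(i, b). f i b)) =
      prod_list (diag_mat (Matrix.mat r r (\<lambda>(i, b). f i b)))"
    by (rule det_lower_triangular[where n = r]) (use assms in auto)
  then show ?thesis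
    by (simp add: prod_list_diag_prod atLeast0LessThan)
qed

lemma poly_eq_sum_coeff_lessThan:
  fixes p :: "'a::comm_ring_1 poly"
  assumes "degree p < r"
  shows "poly p x = (\<Sum>j<r. coeff p j * x ^ j)"
proof -
  have "(\<Sum>j<r. coeff p j * x ^ j) = (\<Sum>j\<le>degree p. coeff p j * x ^ j)"
    by (rule sum.mono_neutral_right) (use assms in \<open>auto simp: coeff_eq_0\<close>)
  then show ?thesis by (simp add: poly_altdef)
qed

text \<open>
  The matrix of values is the matrix of powers of the nodes times the matrix of coefficients.
\<close>

lemma det_poly_factor:
  fixes P :: "nat \<Rightarrow> 'a::comm_ring_1 poly"
  assumes "\<And>b. b < r \<Longrightarrow> degree (P b) < r"
  shows "Determinant.det (Matrix.mat r r (\<lambda>(i, b). poly (P b) (x i))) =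
    Determinant.det (Matrix.mat r r (\<lambda>(i, j). x i ^ j)) *
    Determinant.det (Matrix.mat r r (\<lambda>(j, b). coeff (P b) j))"
proof -
  have "Matrix.mat r r (\<lambda>(i, b). poly (P b) (x i)) =
     Matrix.mat r r (\<lambda>(i, j). x i ^ j) * Matrix.mat r r (\<lambda>(j, b). coeff (P b) j)"
    using assms by (intro eq_matI) (auto simp: scalar_prod_def poly_eq_sum_coeff_lessThan
        atLeast0LessThan mult.commute)
  then show ?thesis by (simp add: det_mult[where n = r])
qed

lemma monic_prod_linear:
  fixes x :: "nat \<Rightarrow> 'a::idom"
  shows "degree (\<Prod>t<b. [:- x t, 1:]) = b" and "lead_coeff (\<Prod>t<b. [:- x t, 1:]) = 1"
  by (subst degree_prod_eq_sum_degree, auto simp: lead_coeff_prod)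

text \<open>
  For the Newton basis \<open>\<Prod>\<^bsub>t<b\<^esub> (X - x\<^sub>t)\<close> the matrix of values is lower triangular with the
  Vandermonde product as determinant, and the coefficient matrix is upper unitriangular.
\<close>

lemma det_vandermonde:
  fixes x :: "nat \<Rightarrow> 'a::idom"
  shows "Determinant.det (Matrix.mat r r (\<lambda>(i, j). x i ^ j)) = vandermonde r x"
proof -
  define N where "N b = (\<Prod>t<b. [:- x t, 1:])" for b :: nat
  have deg: "degree (N b) = b" and lc: "coeff (N b) b = 1" for b
    using monic_prod_linear[of x b] by (simp_all add: N_def)
  have "Determinant.det (Matrix.mat r r (\<lambda>(i, b). poly (N b) (x i))) = (\<Prod>i<r. poly (N i) (x i))"
    by (rule det_triangular_fun) (auto simp: N_def poly_prod prod_zero_iff)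
  also have "\<dots> = vandermonde r x"
    by (simp add: N_def poly_prod vandermonde_def algebra_simps)
  finally have 1: "Determinant.det (Matrix.mat r r (\<lambda>(i, b). poly (N b) (x i))) = vandermonde r x" .
  have "Determinant.det (Matrix.mat r r (\<lambda>(j, b). coeff (N b) j)) =
      prod_list (diag_mat (Matrix.mat r r (\<lambda>(j, b). coeff (N b) j)))"
    by (rule det_upper_triangular[where n = r])
      (auto simp: upper_triangular_def coeff_eq_0 deg)
  then have "Determinant.det (Matrix.mat r r (\<lambda>(j, b). coeff (N b) j)) = 1"
    by (simp add: prod_list_diag_prod lc)
  with det_poly_factor[of r N x] 1 show ?thesis
    by (simp add: deg)
qed

text \<open>
  Evaluation by a second set of nodes: the coefficient determinant does not depend on the nodes,
  and at nodes \<open>z\<close> that make the matrix triangular it is visible.  The equation is stated without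
  division, so that it holds for coinciding nodes as well.
\<close>

lemma det_poly_vandermonde:
  fixes P :: "nat \<Rightarrow> 'a::idom poly"
  assumes deg: "\<And>b. b < r \<Longrightarrow> degree (P b) < r"
    and zero: "\<And>i b. i < b \<Longrightarrow> b < r \<Longrightarrow> poly (P b) (z i) = 0"
  shows "Determinant.det (Matrix.mat r r (\<lambda>(i, b). poly (P b) (x i))) * vandermonde r z =
    vandermonde r x * (\<Prod>i<r. poly (P i) (z i))"
proof -
  have "Determinant.det (Matrix.mat r r (\<lambda>(i, b). poly (P b) (z i))) = (\<Prod>i<r. poly (P i) (z i))"
    by (rule det_triangular_fun) (use zero in auto)
  then show ?thesis
    using det_poly_factor[of r P x, OF deg] det_poly_factor[of r P z, OF deg]
    by (simp add: det_vandermonde mult_ac)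
qed

lemma permutes_in_image_less: "p permutes {0..<r :: nat} \<Longrightarrow> i < r \<Longrightarrow> p i < r"
  using permutes_in_image[of p "{0..<r}" i] by auto

text \<open>
  Expand both determinants over permutations.  For fixed permutations the sum over \<open>k\<close> is a
  product of one-variable sums, and the double sum that results counts the determinant of moments
  once for every permutation of its rows.  The indices of \<open>k\<close> start at 1, those of the matrices at 0.
\<close>

lemma andreief:
  fixes f g :: "nat \<Rightarrow> 'b \<Rightarrow> 'a::{comm_ring_1,ring_char_0}"
  assumes D: "finite D"
  shows "(\<Sum>k\<in>{1..r} \<rightarrow>\<^sub>E D.
       Determinant.det (Matrix.mat r r (\<lambda>(i, a). f a (k (Suc i)))) *
       Determinant.det (Matrix.mat r r (\<lambda>(i, b). g b (k (Suc i)))) * (\<Prod>i=1..r. w (k i))) =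
     fact r * Determinant.det (Matrix.mat r r (\<lambda>(a, b). \<Sum>x\<in>D. f a x * g b x * w x))"
proof -
  let ?S = "{p. p permutes {0..<r}}"
  let ?A = "Matrix.mat r r (\<lambda>(a, b). \<Sum>x\<in>D. f a x * g b x * w x)"
  have shift: "(\<Prod>i=1..r. h i) = (\<Prod>i=0..<r. h (Suc i))" for h :: "nat \<Rightarrow> 'a"
    by (simp add: prod.shift_bounds_Suc_ivl[symmetric] atLeastLessThanSuc_atLeastAtMost)
  have inner: "(\<Sum>k\<in>{1..r} \<rightarrow>\<^sub>E D. (\<Prod>i=0..<r. f (p i) (k (Suc i))) *
       (\<Prod>i=0..<r. g (s i) (k (Suc i))) * (\<Prod>i=1..r. w (k i))) =
      (\<Prod>i=0..<r. ?A $$ (p i, s i))" if p: "p \<in> ?S" and s: "s \<in> ?S" for p s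
  proof -
    have "(\<Sum>k\<in>{1..r} \<rightarrow>\<^sub>E D. (\<Prod>i=0..<r. f (p i) (k (Suc i))) *
       (\<Prod>i=0..<r. g (s i) (k (Suc i))) * (\<Prod>i=1..r. w (k i))) =
      (\<Sum>k\<in>{1..r} \<rightarrow>\<^sub>E D. (\<Prod>i=1..r. f (p (i - 1)) (k i) * g (s (i - 1)) (k i) * w (k i)))"
      unfolding shift by (simp add: prod.distrib)
    also have "\<dots> = (\<Prod>i=1..r. \<Sum>x\<in>D. f (p (i - 1)) x * g (s (i - 1)) x * w x)"
      by (subst prod_sum_PiE) (auto simp: D)
    also have "\<dots> = (\<Prod>i=0..<r. ?A $$ (p i, s i))"
      using p s unfolding shift by (auto simp: permutes_in_image_less intro!: prod.cong)
    finally show ?thesis .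
  qed
  have "(\<Sum>k\<in>{1..r} \<rightarrow>\<^sub>E D.
       Determinant.det (Matrix.mat r r (\<lambda>(i, a). f a (k (Suc i)))) *
       Determinant.det (Matrix.mat r r (\<lambda>(i, b). g b (k (Suc i)))) * (\<Prod>i=1..r. w (k i))) =
     (\<Sum>k\<in>{1..r} \<rightarrow>\<^sub>E D. \<Sum>p\<in>?S. \<Sum>s\<in>?S. signof p * signof s *
       ((\<Prod>i=0..<r. f (p i) (k (Suc i))) *
       (\<Prod>i=0..<r. g (s i) (k (Suc i))) * (\<Prod>i=1..r. w (k i))))"
  proof (intro sum.cong refl)
    fix k
    have 1: "Determinant.det (Matrix.mat r r (\<lambda>(i, a). h a (k (Suc i)))) =
        (\<Sum>p\<in>?S. signof p * (\<Prod>i=0..<r. h (p i) (k (Suc i))))" for h :: "nat \<Rightarrow> 'b \<Rightarrow> 'a"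
      by (subst det_def'[where n = r]) (auto simp: permutes_in_image_less intro!: sum.cong prod.cong)
    show "Determinant.det (Matrix.mat r r (\<lambda>(i, a). f a (k (Suc i)))) *
       Determinant.det (Matrix.mat r r (\<lambda>(i, b). g b (k (Suc i)))) * (\<Prod>i=1..r. w (k i)) =
      (\<Sum>p\<in>?S. \<Sum>s\<in>?S. signof p * signof s *
       ((\<Prod>i=0..<r. f (p i) (k (Suc i))) *
       (\<Prod>i=0..<r. g (s i) (k (Suc i))) * (\<Prod>i=1..r. w (k i))))"
      unfolding 1 sum_product unfolding sum_distrib_right by (intro sum.cong refl) (simp add: mult_ac)
  qed
  also have "\<dots> = (\<Sum>p\<in>?S. \<Sum>s\<in>?S. \<Sum>k\<in>{1..r} \<rightarrow>\<^sub>E D. signof p * signof s *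
       ((\<Prod>i=0..<r. f (p i) (k (Suc i))) *
       (\<Prod>i=0..<r. g (s i) (k (Suc i))) * (\<Prod>i=1..r. w (k i))))"
    by (subst sum.swap, intro sum.cong refl, subst sum.swap, rule refl)
  also have "\<dots> = (\<Sum>p\<in>?S. \<Sum>s\<in>?S. signof p * signof s * (\<Prod>i=0..<r. ?A $$ (p i, s i)))"
    by (intro sum.cong refl, subst sum_distrib_left[symmetric], subst inner) auto
  also have "\<dots> = (\<Sum>p\<in>?S. signof p * Determinant.det (Matrix.mat r r (\<lambda>(i, j). ?A $$ (p i, j))))"
  proof (intro sum.cong refl)
    fix p assume "p \<in> ?S"
    show "(\<Sum>s\<in>?S. signof p * signof s * (\<Prod>i=0..<r. ?A $$ (p i, s i))) =
      signof p * Determinant.det (Matrix.mat r r (\<lambda>(i, j). ?A $$ (p i, j)))"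
      by (subst det_def'[where n = r])
        (auto simp: permutes_in_image_less sum_distrib_left mult.assoc intro!: sum.cong prod.cong)
  qed
  also have "\<dots> = (\<Sum>p\<in>?S. signof p * (signof p * Determinant.det ?A))"
    by (intro sum.cong refl, subst det_permute_rows[where n = r]) auto
  also have "\<dots> = (\<Sum>p\<in>?S. Determinant.det ?A)"
    by (intro sum.cong refl) (simp add: sign_def)
  also have "\<dots> = fact r * Determinant.det ?A"
    by (simp add: card_permutations[of "{0..<r}" r])
  finally show ?thesis .
qed

lemma det_scale_rows:
  fixes g :: "nat \<Rightarrow> 'a::comm_ring_1"
  shows "Determinant.det (Matrix.mat r r (\<lambda>(a, b). g a * h a b)) =
    (\<Prod>a<r. g a) * Determinant.det (Matrix.mat r r (\<lambda>(a, b). h a b))"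
proof -
  have 1: "Determinant.det (Matrix.mat r r (\<lambda>(a, b). f a b)) =
      (\<Sum>p | p permutes {0..<r}. signof p * (\<Prod>i<r. f i (p i)))" for f :: "nat \<Rightarrow> nat \<Rightarrow> 'a"
    by (subst det_def'[where n = r])
      (auto simp: permutes_in_image_less atLeast0LessThan[symmetric] intro!: sum.cong prod.cong)
  show ?thesis
    unfolding 1 by (simp add: prod.distrib sum_distrib_left mult_ac)
qed

section \<open>The q-binomial coefficients and the q-Vandermonde convolution\<close>

lemma alternating_sign_square: "(\<Prod>j<r. (-1) ^ j) * (\<Prod>j<r. (-1) ^ j) = (1::real)"
  by (simp flip: prod.distrib power_mult_distrib)

lemma prod_triangle:
  fixes g :: "nat \<Rightarrow> 'a::comm_monoid_mult"
  shows "(\<Prod>j<r. \<Prod>i<j. g i) = (\<Prod>i<r. g i ^ (r - 1 - i))"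
proof (induction r)
  case (Suc r)
  have "(\<Prod>i<Suc r. g i ^ (Suc r - 1 - i)) = (\<Prod>i<r. g i ^ (r - 1 - i) * g i)"
    by (simp, intro prod.cong refl) (metis Suc_diff_Suc lessThan_iff
        power_Suc mult.commute)
  with Suc show ?case by (simp add: prod.distrib)
qed simp

lemma qpoch_0 [simp]: "qpoch a q 0 = 1"
  by (simp add: qpoch_def)

lemma qpoch_Suc: "qpoch a q (Suc k) = qpoch a q k * (1 - a * q ^ k)"
  by (simp add: qpoch_def)

context
  fixes q :: real
  assumes q: "0 < q" "q < 1"
begin

lemma qpoch_pos: "qpoch q q k > 0"
proof -
  have "q * q ^ j < 1" for j
    using q power_Suc_less_one[of q j] by simp
  then show ?thesis by (simp add: qpoch_def prod_pos)
qed

lemma qpoch_nz [simp]: "qpoch q q k \<noteq> 0"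
  using qpoch_pos[of k] by simp

lemma qpoch_Suc_powr: "qpoch q q (Suc k) = qpoch q q k * (1 - q powr (real k + 1))"
  using q by (simp add: qpoch_Suc powr_add powr_realpow mult.commute)

lemma qbinomial_of_nat:
  "k \<le> n \<Longrightarrow> qbinomial q (int n) (int k) = qpoch q q n / (qpoch q q k * qpoch q q (n - k))"
  by (simp add: qbinomial_def nat_diff_distrib)

lemma qbinomial_outside: "z < 0 \<or> z > N \<Longrightarrow> qbinomial q N z = 0"
  by (auto simp: qbinomial_def)

lemma qbinomial_symmetric: "qbinomial q N (N - z) = qbinomial q N z"
  by (auto simp: qbinomial_def mult.commute)

text \<open>
  Since both coefficients vanish outside \<open>0 \<le> z \<le> N\<close>, the recurrence holds for every integer \<open>z\<close>;
  this makes the shifts of summation ranges below free of side conditions.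
\<close>

lemma qbinomial_pascal:
  "qbinomial q (int (Suc N)) z =
    qbinomial q (int N) z + q powr (real (Suc N) - of_int z) * qbinomial q (int N) (z - 1)"
proof -
  consider "z < 0" | "z > int (Suc N)" | "z = 0" | "z = int (Suc N)"
    | k where "z = int (Suc k)" "k < N"
  proof -
    assume *: "z < 0 \<Longrightarrow> thesis" "z > int (Suc N) \<Longrightarrow> thesis" "z = 0 \<Longrightarrow> thesis"
      "z = int (Suc N) \<Longrightarrow> thesis" "\<And>k. z = int (Suc k) \<Longrightarrow> k < N \<Longrightarrow> thesis"
    show thesis
    proof (cases "0 < z \<and> z < int (Suc N)")
      case True
      then show thesis by (intro *(5)[of "nat z - 1"]) auto
    next
      case False
      then have "z < 0 \<or> z > int (Suc N) \<or> z = 0 \<or> z = int (Suc N)" by linarith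
      then show thesis using *(1-4) by blast
    qed
  qed
  then show ?thesis
  proof cases
    case 1 then show ?thesis by (simp add: qbinomial_outside)
  next
    case 2 then show ?thesis by (simp add: qbinomial_outside)
  next
    case 3
    then show ?thesis
      using qbinomial_of_nat[of 0 "Suc N"] qbinomial_of_nat[of 0 N] by (simp add: qbinomial_outside)
  next
    case 4
    then show ?thesis
      using qbinomial_of_nat[of "Suc N" "Suc N"] qbinomial_of_nat[of N N] q
      by (simp add: qbinomial_outside)
  next
    case (5 k)
    then obtain l where N: "N = Suc (k + l)" using less_imp_Suc_add by auto
    let ?x = "q powr (real k + 1)" and ?y = "q powr (real l + 1)"
    let ?P = "qpoch q q"
    have xy: "q powr (real N + 1) = ?x * ?y" using N by (simp flip: powr_add add: add_ac)
    have e: "real (Suc N) - of_int z = real l + 1" using 5 N by simp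
    have s1: "qbinomial q (int (Suc N)) z = ?P (Suc N) / (?P (Suc k) * ?P (Suc l))"
      using qbinomial_of_nat[of "Suc k" "Suc N"] 5 N by simp
    have s2: "qbinomial q (int N) z = ?P N / (?P (Suc k) * ?P l)"
      using qbinomial_of_nat[of "Suc k" N] 5 N by simp
    have s3: "qbinomial q (int N) (z - 1) = ?P N / (?P k * ?P (Suc l))"
      using qbinomial_of_nat[of k N] 5 N by simp
    have nz: "1 - ?x \<noteq> 0" "1 - ?y \<noteq> 0"
      using qpoch_nz[of "Suc k"] qpoch_nz[of "Suc l"] unfolding qpoch_Suc_powr by auto
    show ?thesis
      unfolding s1 s2 s3 e qpoch_Suc_powr xy using nz
      by (simp add: divide_simps) (simp add: algebra_simps)
  qed
qed

lemma qbinomial_pascal':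
  "qbinomial q (int (Suc N)) z =
    qbinomial q (int N) (z - 1) + q powr of_int z * qbinomial q (int N) z"
proof -
  have *: "int N - (int (Suc N) - z) = z - 1" "int N - (int (Suc N) - z - 1) = z" by auto
  show ?thesis
    using qbinomial_pascal[of N "int (Suc N) - z"]
      qbinomial_symmetric[of "int (Suc N)" z] qbinomial_symmetric[of "int N" "int (Suc N) - z"]
      qbinomial_symmetric[of "int N" "int (Suc N) - z - 1"]
    unfolding * by simp
qed

text \<open>
  Induction on \<open>N\<close>.  The first Pascal rule splits the sum into the sums for \<open>(N, d)\<close> and, after
  \<open>j \<mapsto> j + 1\<close>, for \<open>(N, d + 1)\<close> with factor \<open>q\<^bsup>N + 1 + d\<^esup>\<close>; the second Pascal rule recombines them.
  The integer offset \<open>d\<close> and the arbitrary index set \<open>J\<close> allow shifted convolutions.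
\<close>

lemma q_vandermonde:
  assumes "finite J" "{0..int N} \<subseteq> J"
  shows "(\<Sum>j\<in>J. q powr of_int (j * (d + j)) * qbinomial q (int N) j * qbinomial q (int M) (d + j)) =
    qbinomial q (int (N + M)) (int N + d)"
proof -
  define V where "V N d = (\<Sum>j\<in>{0..int N}. q powr of_int (j * (d + j)) *
      qbinomial q (int N) j * qbinomial q (int M) (d + j))" for N d
  have ext: "(\<Sum>j\<in>J. q powr of_int (j * (d + j)) * qbinomial q (int N) j *
      qbinomial q (int M) (d + j)) = V N d"
    if "finite J" "{0..int N} \<subseteq> J" for J N d
    unfolding V_def by (rule sum.mono_neutral_right) (use that in \<open>auto simp: qbinomial_outside\<close>)
  have "V N d = qbinomial q (int (N + M)) (int N + d)" for d
  proof (induction N arbitrary: d)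
    case 0
    show ?case using qbinomial_of_nat[of 0 0] q by (simp add: V_def)
  next
    case (Suc N)
    let ?I = "{0..int (Suc N)}"
    have "V (Suc N) d = (\<Sum>j\<in>?I. q powr of_int (j * (d + j)) *
        qbinomial q (int N) j * qbinomial q (int M) (d + j)) +
        (\<Sum>j\<in>?I. q powr of_int (j * (d + j)) * q powr (real (Suc N) - of_int j) *
          qbinomial q (int N) (j - 1) * qbinomial q (int M) (d + j))"
      unfolding V_def qbinomial_pascal sum.distrib[symmetric]
      by (intro sum.cong refl) (simp add: algebra_simps)
    also have "(\<Sum>j\<in>?I. q powr of_int (j * (d + j)) *
        qbinomial q (int N) j * qbinomial q (int M) (d + j)) = V N d"
      by (rule ext) auto
    also have "(\<Sum>j\<in>?I. q powr of_int (j * (d + j)) * q powr (real (Suc N) - of_int j) *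
          qbinomial q (int N) (j - 1) * qbinomial q (int M) (d + j)) =
        (\<Sum>j\<in>{-1..int N}. q powr of_int ((j + 1) * (d + (j + 1))) *
          q powr (real (Suc N) - of_int (j + 1)) *
          qbinomial q (int N) j * qbinomial q (int M) (d + (j + 1)))"
      by (rule sum.reindex_bij_witness[of _ "\<lambda>j. j + 1" "\<lambda>j. j - 1"]) auto
    also have "\<dots> = q powr of_int (int N + 1 + d) *
        (\<Sum>j\<in>{-1..int N}. q powr of_int (j * (d + 1 + j)) *
          qbinomial q (int N) j * qbinomial q (int M) (d + 1 + j))"
      unfolding sum_distrib_left
    proof (intro sum.cong refl)
      fix j :: int
      have 1: "q powr of_int ((j + 1) * (d + (j + 1))) * q powr (real (Suc N) - of_int (j + 1)) =
          q powr of_int (int N + 1 + d) * q powr of_int (j * (d + 1 + j))"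
        unfolding powr_add[symmetric] by (rule arg_cong[where f = "\<lambda>x. q powr x"])
          (simp add: algebra_simps)
      have 2: "d + (j + 1) = d + 1 + j" by simp
      show "q powr of_int ((j + 1) * (d + (j + 1))) * q powr (real (Suc N) - of_int (j + 1)) *
          qbinomial q (int N) j * qbinomial q (int M) (d + (j + 1)) =
        q powr of_int (int N + 1 + d) * (q powr of_int (j * (d + 1 + j)) *
          qbinomial q (int N) j * qbinomial q (int M) (d + 1 + j))"
        unfolding 1 unfolding 2 by (simp only: mult.assoc)
    qed
    also have "\<dots> = q powr of_int (int N + 1 + d) * V N (d + 1)"
      by (subst ext) auto
    finally show ?case
      using qbinomial_pascal'[of "N + M" "int N + 1 + d"] by (simp add: Suc add_ac)
  qed
  with ext[OF assms] show ?thesis by simp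
qed

lemma qpoch_falling:
  "a \<le> j \<Longrightarrow> (\<Prod>t<a. 1 - q powr (real j - real t)) = qpoch q q j / qpoch q q (j - a)"
proof (induction a)
  case (Suc a)
  then have "j - a = Suc (j - Suc a)" by simp
  moreover have "1 + real (j - Suc a) = real j - real a" using Suc.prems by simp
  ultimately have "qpoch q q (j - a) = qpoch q q (j - Suc a) * (1 - q powr (real j - real a))"
    using qpoch_Suc_powr[of "j - Suc a"] by (simp add: add.commute)
  moreover have "qpoch q q (j - a) \<noteq> 0" by simp
  ultimately show ?case using Suc by simp
qed simp

lemma qfalling_eq_0:
  "z < a \<Longrightarrow> (\<Prod>t<a. 1 - q powr (real z - real t)) = 0"
  using q by (intro prod_zero) (auto intro!: bexI[of _ z])

text \<open>
  The first product lowers the argument \<open>z\<close>, the second its complement \<open>N - z\<close>.  Where the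
  coefficient on the right vanishes and the one on the left does not, one of the two products
  contains the factor \<open>1 - q\<^sup>0\<close>.
\<close>

lemma qbinomial_absorb:
  fixes z :: int
  assumes "a + b \<le> N"
  shows "(\<Prod>t<a. 1 - q powr (of_int z - real t)) * (\<Prod>t<b. 1 - q powr (real N - of_int z - real t)) *
      qbinomial q (int N) z =
    qpoch q q N / qpoch q q (N - a - b) * qbinomial q (int (N - a - b)) (z - int a)"
proof (cases "0 \<le> z \<and> z \<le> int N")
  case False
  then have "z < 0 \<or> z > int N" by auto
  then have "qbinomial q (int N) z = 0"
    and "qbinomial q (int (N - a - b)) (z - int a) = 0"
    using assms by (auto intro!: qbinomial_outside)
  then show ?thesis by (simp only: mult_zero_right)
next
  case True
  obtain j where j: "z = int j" "j \<le> N"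
    by (rule that[of "nat z"]) (use True in auto)
  have jj: "real N - of_int z = real (N - j)" using j by simp
  show ?thesis
  proof (cases "a \<le> j \<and> b \<le> N - j")
    case False
    then have "j < a \<or> N - j < b" by auto
    then have "(\<Prod>t<a. 1 - q powr (of_int z - real t)) *
        (\<Prod>t<b. 1 - q powr (real N - of_int z - real t)) = 0"
      unfolding jj using qfalling_eq_0[of j a] qfalling_eq_0[of "N - j" b] j(1) by auto
    moreover have "qbinomial q (int (N - a - b)) (z - int a) = 0"
      by (rule qbinomial_outside) (use \<open>j < a \<or> N - j < b\<close> j assms in auto)
    ultimately show ?thesis by simp
  next
    case True
    have 1: "qbinomial q (int (N - a - b)) (z - int a) =
        qpoch q q (N - a - b) / (qpoch q q (j - a) * qpoch q q (N - j - b))"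
    proof -
      have "z - int a = int (j - a)" using j True by simp
      moreover have "N - a - b - (j - a) = N - j - b" using j True by simp
      moreover have "j - a \<le> N - a - b" using j True assms by linarith
      ultimately show ?thesis
        using qbinomial_of_nat[of "j - a" "N - a - b"] by (simp only:)
    qed
    show ?thesis
      unfolding jj 1 using True j qpoch_falling[of a j] qpoch_falling[of b "N - j"]
      by (simp add: qbinomial_of_nat)
  qed
qed

end

section \<open>A basis of polynomials with product-form determinant\<close>

text \<open>
  For every \<open>b < r\<close> the degree is \<open>r - 1\<close>; only this uniform degree matches the exponents
  in the \<open>q\<close>-Vandermonde convolution.  The parameters \<open>c\<close> and \<open>u\<close> are logarithms to base \<open>q\<close>;
  \<open>c\<close> may be negative.
\<close>

definition basis_poly :: "real \<Rightarrow> nat \<Rightarrow> real \<Rightarrow> real \<Rightarrow> nat \<Rightarrow> real poly" where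
  "basis_poly q r c u b =
    (\<Prod>t<b. [:1, - (q powr (c - real t)):]) * (\<Prod>t<r - 1 - b. [:- (q powr (u - real t)), 1:])"

context
  fixes q :: real
  assumes q: "0 < q" "q < 1"
begin

lemma poly_basis_poly:
  "poly (basis_poly q r c u b) (q powr x) =
    (\<Prod>t<b. 1 - q powr (c + x - real t)) *
    (q powr (x * real (r - 1 - b)) * (\<Prod>t<r - 1 - b. 1 - q powr (u - x - real t)))"
proof -
  have 1: "poly (\<Prod>t<b. [:1, - (q powr (c - real t)):]) (q powr x) =
      (\<Prod>t<b. 1 - q powr (c + x - real t))"
    by (auto simp: poly_prod simp flip: powr_add intro!: prod.cong arg_cong[of _ _ "\<lambda>x. q powr x"])
  have "poly (\<Prod>t<r - 1 - b. [:- (q powr (u - real t)), 1:]) (q powr x) =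
      (\<Prod>t<r - 1 - b. q powr x * (1 - q powr (u - x - real t)))"
    by (auto simp: poly_prod right_diff_distrib simp flip: powr_add intro!: prod.cong)
  also have "\<dots> = q powr (x * real (r - 1 - b)) * (\<Prod>t<r - 1 - b. 1 - q powr (u - x - real t))"
    using q by (simp add: prod.distrib powr_powr flip: powr_realpow)
  finally show ?thesis by (simp add: basis_poly_def 1)
qed

lemma degree_basis_poly: "b < r \<Longrightarrow> degree (basis_poly q r c u b) < r"
proof -
  assume "b < r"
  have "degree (\<Prod>t<b. [:1, - (q powr (c - real t)):]) \<le> b"
    using degree_prod_sum_le[of "{..<b}" "\<lambda>t. [:1, - (q powr (c - real t)):]"] q by simp
  moreover have "degree (\<Prod>t<r - 1 - b. [:- (q powr (u - real t)), 1:]) \<le> r - 1 - b"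
    using degree_prod_sum_le[of "{..<r - 1 - b}" "\<lambda>t. [:- (q powr (u - real t)), 1:]"] by simp
  ultimately show ?thesis
    unfolding basis_poly_def using \<open>b < r\<close> degree_mult_le[of "\<Prod>t<b. [:1, - (q powr (c - real t)):]"
        "\<Prod>t<r - 1 - b. [:- (q powr (u - real t)), 1:]"] by linarith
qed

text \<open>
  With \<open>c + x = z\<close> and \<open>u - x = e - z\<close> the two groups of factors of the basis polynomial are those of
  the absorption rule.
\<close>

lemma basis_poly_qbinomial:
  assumes b: "b < r" and e: "r - 1 \<le> e" "c + u = real e" and z: "c + x = of_int z"
  shows "poly (basis_poly q r c u b) (q powr x) * qbinomial q (int e) z =
    q powr (x * real (r - 1 - b)) * (qpoch q q e / qpoch q q (e - (r - 1))) *
    qbinomial q (int (e - (r - 1))) (z - int b)"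
proof -
  have ux: "u - x = real e - of_int z" using e z by simp
  have "e - b - (r - 1 - b) = e - (r - 1)" using b by simp
  with qbinomial_absorb[OF q, of b "r - 1 - b" e z] b e(1)
  have absorb: "(\<Prod>t<b. 1 - q powr (of_int z - real t)) *
      (\<Prod>t<r - 1 - b. 1 - q powr (real e - of_int z - real t)) * qbinomial q (int e) z =
    qpoch q q e / qpoch q q (e - (r - 1)) * qbinomial q (int (e - (r - 1))) (z - int b)"
    by simp
  have "poly (basis_poly q r c u b) (q powr x) * qbinomial q (int e) z =
    q powr (x * real (r - 1 - b)) * ((\<Prod>t<b. 1 - q powr (of_int z - real t)) *
      (\<Prod>t<r - 1 - b. 1 - q powr (real e - of_int z - real t)) * qbinomial q (int e) z)"
    unfolding poly_basis_poly z ux by (simp only: mult_ac)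
  then show ?thesis unfolding absorb by (simp only: mult.assoc)
qed

lemma vandermonde_q_powers:
  "vandermonde r (\<lambda>i. q powr (real i - c)) =
    (\<Prod>j<r. (-1) ^ j) * (\<Prod>i<r. (q powr (real i - c)) ^ (r - 1 - i)) * (\<Prod>i<r. qpoch q q i)"
proof -
  have "(\<Prod>i<j. q powr (real j - c) - q powr (real i - c)) =
      (-1) ^ j * (\<Prod>i<j. q powr (real i - c)) * qpoch q q j" for j
  proof -
    have "(\<Prod>i<j. q powr (real j - c) - q powr (real i - c)) =
        (\<Prod>i<j. - 1 * q powr (real i - c) * (1 - q powr (real j - real i)))"
      by (intro prod.cong refl) (simp add: algebra_simps flip: powr_add)
    then show ?thesis using qpoch_falling[OF q, of j j] by (simp only: prod.distrib) simp
  qed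
  then show ?thesis
    by (simp add: vandermonde_def prod.distrib prod_triangle)
qed

text \<open>
  At the node \<open>q\<^bsup>i - c\<^esup>\<close> the polynomials with \<open>b > i\<close> contain a vanishing factor, so the matrix is
  triangular there.  The powers of \<open>q\<close> on its diagonal cancel against those in the Vandermonde
  product of these nodes, which is why the constant depends on \<open>c\<close> and \<open>u\<close> only through their sum.
\<close>

lemma det_basis_poly:
  assumes e: "r - 1 \<le> e" "c + u = real e"
  shows "Determinant.det (Matrix.mat r r (\<lambda>(i, b). poly (basis_poly q r c u b) (x i))) =
    (\<Prod>j<r. (-1) ^ j) * vandermonde r x * (\<Prod>i<r. qpoch q q (e - i) / qpoch q q (e - (r - 1)))"
proof -
  define z where "z i = q powr (real i - c)" for i
  define Q where "Q = (\<Prod>i<r. z i ^ (r - 1 - i)) * (\<Prod>i<r. qpoch q q i)"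
  have Vz: "vandermonde r z = (\<Prod>j<r. (-1) ^ j) * Q"
    using vandermonde_q_powers[of r c] by (simp add: z_def[abs_def] Q_def)
  have Qnz: "Q \<noteq> 0" using q by (auto simp: Q_def z_def)
  have zero: "poly (basis_poly q r c u b) (z i) = 0" if "i < b" for i b
    using qfalling_eq_0[OF q that] by (simp add: z_def poly_basis_poly)
  have diag: "poly (basis_poly q r c u i) (z i) =
      z i ^ (r - 1 - i) * qpoch q q i * (qpoch q q (e - i) / qpoch q q (e - (r - 1)))"
    if "i < r" for i
  proof -
    have 1: "u - (real i - c) = real (e - i)" "c + (real i - c) = real i" using e that by auto
    have "e - i - (r - 1 - i) = e - (r - 1)" using that by simp
    then have 2: "(\<Prod>t<r - 1 - i. 1 - q powr (real (e - i) - real t)) =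
        qpoch q q (e - i) / qpoch q q (e - (r - 1))"
      using qpoch_falling[OF q, of "r - 1 - i" "e - i"] e(1) by (simp only:) simp
    have 3: "q powr ((real i - c) * real (r - 1 - i)) = z i ^ (r - 1 - i)"
      using q by (simp add: z_def powr_powr flip: powr_realpow)
    have 4: "(\<Prod>t<i. 1 - q powr (real i - real t)) = qpoch q q i"
      using qpoch_falling[OF q, of i i] by simp
    show ?thesis
      unfolding z_def[of i] poly_basis_poly 1 2 3 4 unfolding z_def by (simp only: mult_ac)
  qed
  have "Determinant.det (Matrix.mat r r (\<lambda>(i, b). poly (basis_poly q r c u b) (x i))) * vandermonde r z
      = vandermonde r x * (\<Prod>i<r. poly (basis_poly q r c u i) (z i))"
    by (rule det_poly_vandermonde) (use degree_basis_poly zero in auto)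
  also have "(\<Prod>i<r. poly (basis_poly q r c u i) (z i)) =
      Q * (\<Prod>i<r. qpoch q q (e - i) / qpoch q q (e - (r - 1)))"
    unfolding Q_def prod.distrib[symmetric] by (intro prod.cong) (auto simp: diag)
  finally have "Determinant.det (Matrix.mat r r (\<lambda>(i, b). poly (basis_poly q r c u b) (x i))) *
      (\<Prod>j<r. (-1) ^ j) * Q = vandermonde r x *
      (\<Prod>i<r. qpoch q q (e - i) / qpoch q q (e - (r - 1))) * Q"
    by (simp add: Vz mult_ac)
  then have 1: "Determinant.det (Matrix.mat r r (\<lambda>(i, b). poly (basis_poly q r c u b) (x i))) *
      (\<Prod>j<r. (-1) ^ j) = vandermonde r x *
      (\<Prod>i<r. qpoch q q (e - i) / qpoch q q (e - (r - 1)))"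
    using Qnz by simp
  have 2: "(\<Prod>j<r. (-1) ^ j) * (\<Prod>j<r. (-1) ^ j) = (1::real)"
    by (rule alternating_sign_square)
  have "Determinant.det (Matrix.mat r r (\<lambda>(i, b). poly (basis_poly q r c u b) (x i))) =
      Determinant.det (Matrix.mat r r (\<lambda>(i, b). poly (basis_poly q r c u b) (x i))) *
      (\<Prod>j<r. (-1) ^ j) * (\<Prod>j<r. (-1) ^ j)"
    using 2 by (simp add: mult.assoc)
  then show ?thesis unfolding 1 by (simp only: mult_ac)
qed

end

section \<open>The Hankel-type determinant of moments\<close>

context
  fixes q :: real
  assumes q: "0 < q" "q < 1"
begin

text \<open>
  Absorption, read from right to left, expresses \<open>[2L, L + a - b]\<close> by \<open>[2L + r - 1, L + a]\<close>, which
  depends on the row only, and the value of a basis polynomial at \<open>q\<^sup>a\<close>.  The factor \<open>q\<^bsup>-ab\<^esup>\<close> of the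
  entries merges with the power of \<open>q\<close> from absorption into another row factor.
\<close>

lemma det_qbinomial_toeplitz:
  fixes K D :: real and L r :: nat
  shows "Determinant.det (Matrix.mat r r (\<lambda>(a, b). K * q powr (real a * (D - real b)) *
      qbinomial q (int (2 * L)) (int L + int a - int b))) =
    (\<Prod>i<r. K * q powr (real i * D - (real i)\<^sup>2) * qpoch q q i *
      qpoch q q (2 * L + (r - 1) - i) / (qpoch q q (L + i) * qpoch q q (L + (r - 1 - i))))"
proof -
  let ?e = "2 * L + (r - 1)"
  let ?B = "basis_poly q r (real L) (real (L + (r - 1)))"
  define g where "g a = K * q powr (real a * D - real a * real (r - 1)) * qpoch q q (2 * L) /
      (qpoch q q (L + a) * qpoch q q (L + (r - 1 - a)))" for a
  have nz: "qpoch q q i \<noteq> 0" for i using qpoch_nz[OF q] .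
  have entry: "K * q powr (real a * (D - real b)) * qbinomial q (int (2 * L)) (int L + int a - int b) =
      g a * poly (?B b) (q powr real a)" if a: "a < r" and b: "b < r" for a b
  proof -
    have 1: "poly (?B b) (q powr real a) * qbinomial q (int ?e) (int (L + a)) =
        q powr (real a * real (r - 1 - b)) * (qpoch q q ?e / qpoch q q (2 * L)) *
        qbinomial q (int (2 * L)) (int L + int a - int b)"
      using basis_poly_qbinomial[OF q b, of ?e "real L" "real (L + (r - 1))" "real a" "int (L + a)"]
      by simp
    have 2: "qbinomial q (int ?e) (int (L + a)) =
        qpoch q q ?e / (qpoch q q (L + a) * qpoch q q (L + (r - 1 - a)))"
    proof -
      have "?e - (L + a) = L + (r - 1 - a)" using a by linarith
      moreover have "L + a \<le> ?e" using a by linarith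
      ultimately show ?thesis using qbinomial_of_nat[OF q, of "L + a" ?e] by (simp only:)
    qed
    have 3: "q powr (real a * (D - real b)) =
        q powr (real a * D - real a * real (r - 1)) * q powr (real a * real (r - 1 - b))"
    proof -
      have rb: "real (r - 1 - b) = real (r - 1) - real b" using b by linarith
      show ?thesis unfolding powr_add[symmetric] rb by (simp add: algebra_simps)
    qed
    have 4: "q powr (real a * real (r - 1 - b)) *
        qbinomial q (int (2 * L)) (int L + int a - int b) = poly (?B b) (q powr real a) *
        qpoch q q (2 * L) / (qpoch q q (L + a) * qpoch q q (L + (r - 1 - a)))"
      using 1[unfolded 2] nz[of ?e] nz[of "2 * L"] nz[of "L + a"] nz[of "L + (r - 1 - a)"]
      by (simp add: field_simps)
    have "K * q powr (real a * (D - real b)) * qbinomial q (int (2 * L)) (int L + int a - int b) =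
      K * q powr (real a * D - real a * real (r - 1)) * (q powr (real a * real (r - 1 - b)) *
        qbinomial q (int (2 * L)) (int L + int a - int b))"
      unfolding 3 by (simp only: mult_ac)
    then show ?thesis unfolding 4 g_def by simp
  qed
  have "Determinant.det (Matrix.mat r r (\<lambda>(a, b). K * q powr (real a * (D - real b)) *
      qbinomial q (int (2 * L)) (int L + int a - int b))) =
      Determinant.det (Matrix.mat r r (\<lambda>(a, b). g a * poly (?B b) (q powr real a)))"
    by (rule arg_cong[where f = Determinant.det], rule cong_mat[OF refl refl])
      (simp only: prod.case entry)
  also have "\<dots> = (\<Prod>a<r. g a) *
      Determinant.det (Matrix.mat r r (\<lambda>(a, b). poly (?B b) (q powr real a)))"
    by (rule det_scale_rows)
  also have "Determinant.det (Matrix.mat r r (\<lambda>(a, b). poly (?B b) (q powr real a))) =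
      (\<Prod>j<r. (-1) ^ j) * vandermonde r (\<lambda>i. q powr real i) *
      (\<Prod>i<r. qpoch q q (?e - i) / qpoch q q (2 * L))"
    using det_basis_poly[OF q, of r ?e "real L" "real (L + (r - 1))" "\<lambda>i. q powr real i"] by simp
  also have "vandermonde r (\<lambda>i. q powr real i) =
      (\<Prod>j<r. (-1) ^ j) * (\<Prod>i<r. (q powr real i) ^ (r - 1 - i)) * (\<Prod>i<r. qpoch q q i)"
    using vandermonde_q_powers[OF q, of r 0] by simp
  also have "(\<Prod>a<r. g a) * ((\<Prod>j<r. (-1) ^ j) * ((\<Prod>j<r. (-1) ^ j) *
      (\<Prod>i<r. (q powr real i) ^ (r - 1 - i)) * (\<Prod>i<r. qpoch q q i)) *
      (\<Prod>i<r. qpoch q q (?e - i) / qpoch q q (2 * L))) =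
      (\<Prod>i<r. g i * (q powr real i) ^ (r - 1 - i) * qpoch q q i *
        (qpoch q q (?e - i) / qpoch q q (2 * L)))"
  proof -
    have EE: "(\<Prod>j<r. (-1) ^ j) * (\<Prod>j<r. (-1) ^ j) = (1::real)"
    by (rule alternating_sign_square)
    have "G * (E * (E * Q * R) * T) = E * E * (G * Q * R * T)" for E G Q R T :: real
      by (simp only: mult_ac)
    then show ?thesis by (simp only: prod.distrib EE mult_1)
  qed
  also have "\<dots> = (\<Prod>i<r. K * q powr (real i * D - (real i)\<^sup>2) * qpoch q q i *
      qpoch q q (?e - i) / (qpoch q q (L + i) * qpoch q q (L + (r - 1 - i))))"
  proof (rule prod.cong[OF refl])
    fix i assume i: "i \<in> {..<r}"
    have "(q powr real i) ^ (r - 1 - i) = q powr (real i * real (r - 1 - i))"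
      using q by (simp add: powr_powr flip: powr_realpow)
    also have "real (r - 1 - i) = real (r - 1) - real i" using i by auto
    finally have 1: "q powr (real i * D - real i * real (r - 1)) * (q powr real i) ^ (r - 1 - i) =
        q powr (real i * D - (real i)\<^sup>2)"
      by (simp flip: powr_add add: algebra_simps power2_eq_square)
    have "g i * (q powr real i) ^ (r - 1 - i) * qpoch q q i * (qpoch q q (?e - i) / qpoch q q (2 * L)) =
        K * (q powr (real i * D - real i * real (r - 1)) * (q powr real i) ^ (r - 1 - i)) * qpoch q q i *
        qpoch q q (?e - i) / (qpoch q q (L + i) * qpoch q q (L + (r - 1 - i)))"
      unfolding g_def using nz[of "2 * L"] by (simp add: field_simps)
    then show "g i * (q powr real i) ^ (r - 1 - i) * qpoch q q i * (qpoch q q (?e - i) / qpoch q q (2 * L)) =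
        K * q powr (real i * D - (real i)\<^sup>2) * qpoch q q i *
        qpoch q q (?e - i) / (qpoch q q (L + i) * qpoch q q (L + (r - 1 - i)))"
      unfolding 1 .
  qed
  finally show ?thesis .
qed

end

lemma sum_over_sum_range:
  assumes n: "2 * n = real N"
  shows "(\<Sum>k\<in>sum_range n. h k) = (\<Sum>j\<in>{0..int N}. h (of_int j - n))"
proof (rule sum.reindex_bij_witness[of _ "\<lambda>j. of_int j - n" "\<lambda>k. \<lfloor>n + k\<rfloor>"])
  fix k assume k: "k \<in> sum_range n"
  then obtain z where z: "k - n = of_int z" by (auto simp: sum_range_def elim: Ints_cases)
  have nk: "n + k = of_int (z + int N)" using z n by simp
  show "of_int \<lfloor>n + k\<rfloor> - n = k" unfolding nk floor_of_int using nk by simp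
  show "\<lfloor>n + k\<rfloor> \<in> {0..int N}"
    unfolding nk floor_of_int using k nk n by (simp add: sum_range_def)
  show "h (of_int \<lfloor>n + k\<rfloor> - n) = h k" using \<open>of_int \<lfloor>n + k\<rfloor> - n = k\<close> by simp
next
  fix j assume j: "j \<in> {0..int N}"
  show "\<lfloor>n + (of_int j - n)\<rfloor> = j" by simp
  have "of_int j - n - n = of_int (j - int N)" using n by simp
  then have "of_int j - n - n \<in> \<int>" by (metis Ints_of_int)
  moreover have "(of_int j :: real) \<le> real N" using j by (simp add: of_int_le_iff[of j "int N", symmetric] del: of_int_le_iff)
  ultimately show "of_int j - n \<in> sum_range n" using j n by (simp add: sum_range_def)
qed

lemma finite_sum_range:
  assumes n: "2 * n = real N"
  shows "finite (sum_range n)" and "card (sum_range n) \<le> Suc N"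
proof -
  have *: "sum_range n \<subseteq> (\<lambda>j. real j - n) ` {0..N}"
  proof
    fix k assume k: "k \<in> sum_range n"
    then obtain z where z: "k - n = of_int z" by (auto simp: sum_range_def elim: Ints_cases)
    have nk: "n + k = of_int (z + int N)" using z n by simp
    then have "0 \<le> z + int N" "z + int N \<le> int N"
      using k n by (simp_all add: sum_range_def)
    then have "k = real (nat (z + int N)) - n" "nat (z + int N) \<in> {0..N}"
      using nk by auto
    then show "k \<in> (\<lambda>j. real j - n) ` {0..N}" by blast
  qed
  show "finite (sum_range n)" by (rule finite_subset[OF *]) simp
  show "card (sum_range n) \<le> Suc N"
    using card_mono[OF _ *] card_image_le[of "{0..N}" "\<lambda>j. real j - n"] by simp
qed

text \<open>
  The symmetrized one-variable weight: its exponent contains \<open>-2r + 2\<close> in place of \<open>-2i + 2\<close>.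
\<close>

definition weight :: "real \<Rightarrow> real \<Rightarrow> real \<Rightarrow> nat \<Rightarrow> real \<Rightarrow> real" where
  "weight q m n r k = q powr (k\<^sup>2 + (m + n - 2 * real r + 2) * k) *
    qbinomial q \<lfloor>2 * n\<rfloor> \<lfloor>n + k\<rfloor> * qbinomial q \<lfloor>2 * m\<rfloor> \<lfloor>m + k\<rfloor>"

context
  fixes q m n :: real and r N M s :: nat
  assumes q: "0 < q" "q < 1" and r: "r \<ge> 1"
    and N: "2 * n = real N" and M: "2 * m = real M" and s: "m + n = real s"
    and rN: "r - 1 \<le> N" and rM: "r - 1 \<le> M"
begin

text \<open>
  Put \<open>j = n + k\<close> and \<open>d = m - n\<close>.  The first polynomial is absorbed by \<open>[2n, j]\<close>, the second by
  \<open>[2m, d + j]\<close>.  The powers of \<open>q\<close> then combine to \<open>(j - a)(d + j - b)\<close>, the exponent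
  of a \<open>q\<close>-Vandermonde sum over \<open>j - a\<close>.
\<close>

lemma moment:
  assumes a: "a < r" and b: "b < r"
  shows "(\<Sum>k\<in>sum_range n. poly (basis_poly q r 0 (real N) a) (q powr (n + k)) *
      poly (basis_poly q r (m - n) (real s) b) (q powr (n + k)) * weight q m n r k) =
    q powr (2 * (real r - 1) * n - m * n) *
    (qpoch q q N / qpoch q q (N - (r - 1)) * (qpoch q q M / qpoch q q (M - (r - 1)))) *
    q powr (real a * (m - n - real b)) *
    qbinomial q (int (2 * (s - (r - 1)))) (int (s - (r - 1)) + int a - int b)"
proof -
  define d :: int where "d = int M - int s"
  let ?N' = "N - (r - 1)" and ?M' = "M - (r - 1)"
  let ?C = "qpoch q q N / qpoch q q ?N' * (qpoch q q M / qpoch q q ?M')"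
  have d: "of_int d = m - n" using M s by (simp add: d_def)
  have NMs: "N + M = 2 * s" using N M s by linarith
  let ?t = "\<lambda>j. q powr of_int ((j - int a) * (d + j - int b)) *
      qbinomial q (int ?N') (j - int a) * qbinomial q (int ?M') (d + j - int b)"
  have summand: "poly (basis_poly q r 0 (real N) a) (q powr (n + (of_int j - n))) *
      poly (basis_poly q r (m - n) (real s) b) (q powr (n + (of_int j - n))) * weight q m n r (of_int j - n) =
      q powr (2 * (real r - 1) * n - m * n) * ?C * q powr (real a * (m - n - real b)) * ?t j" for j
  proof -
    have x: "n + (of_int j - n) = of_int j" by simp
    have f: "\<lfloor>2 * n\<rfloor> = int N" "\<lfloor>n + (of_int j - n)\<rfloor> = j" "\<lfloor>2 * m\<rfloor> = int M"
      using N M by simp_all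
    have f4: "\<lfloor>m + (of_int j - n)\<rfloor> = d + j"
    proof -
      have "m + (of_int j - n) = of_int (d + j)" using d by simp
      then show ?thesis by (simp only: floor_of_int)
    qed
    have p1: "poly (basis_poly q r 0 (real N) a) (q powr of_int j) * qbinomial q (int N) j =
        q powr (of_int j * real (r - 1 - a)) * (qpoch q q N / qpoch q q ?N') *
        qbinomial q (int ?N') (j - int a)"
      by (rule basis_poly_qbinomial) (use q a rN in auto)
    have p2: "poly (basis_poly q r (m - n) (real s) b) (q powr of_int j) * qbinomial q (int M) (d + j) =
        q powr (of_int j * real (r - 1 - b)) * (qpoch q q M / qpoch q q ?M') *
        qbinomial q (int ?M') (d + j - int b)"
      by (rule basis_poly_qbinomial) (use q b rM M s d in auto)
    have ex: "q powr ((of_int j - n)\<^sup>2 + (m + n - 2 * real r + 2) * (of_int j - n)) *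
        q powr (of_int j * real (r - 1 - a)) * q powr (of_int j * real (r - 1 - b)) =
        q powr (2 * (real r - 1) * n - m * n) * q powr (real a * (m - n - real b)) *
        q powr of_int ((j - int a) * (d + j - int b))"
    proof -
      have ra: "real (r - 1 - a) = real r - 1 - real a" "real (r - 1 - b) = real r - 1 - real b"
        using a b by auto
      show ?thesis
        unfolding powr_add[symmetric] of_int_mult of_int_diff of_int_add d ra
        by (rule arg_cong[where f = "\<lambda>x. q powr x"]) (simp add: algebra_simps power2_eq_square)
    qed
    have "poly (basis_poly q r 0 (real N) a) (q powr of_int j) *
      poly (basis_poly q r (m - n) (real s) b) (q powr of_int j) * weight q m n r (of_int j - n) =
      q powr ((of_int j - n)\<^sup>2 + (m + n - 2 * real r + 2) * (of_int j - n)) *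
      (poly (basis_poly q r 0 (real N) a) (q powr of_int j) * qbinomial q (int N) j) *
      (poly (basis_poly q r (m - n) (real s) b) (q powr of_int j) * qbinomial q (int M) (d + j))"
      unfolding weight_def f f4 by (simp only: mult_ac)
    also have "\<dots> = (q powr ((of_int j - n)\<^sup>2 + (m + n - 2 * real r + 2) * (of_int j - n)) *
        q powr (of_int j * real (r - 1 - a)) * q powr (of_int j * real (r - 1 - b))) * ?C *
        qbinomial q (int ?N') (j - int a) * qbinomial q (int ?M') (d + j - int b)"
      unfolding p1 p2 by (simp only: mult_ac)
    finally show ?thesis unfolding x ex by (simp only: mult_ac)
  qed
  have "(\<Sum>j\<in>{0..int N}. ?t j) = (\<Sum>i\<in>{- int a..int N - int a}.
      q powr of_int (i * (d + int a - int b + i)) * qbinomial q (int ?N') i *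
      qbinomial q (int ?M') (d + int a - int b + i))"
    by (rule sum.reindex_bij_witness[of _ "\<lambda>i. i + int a" "\<lambda>j. j - int a"])
      (auto simp: algebra_simps)
  also have "\<dots> = qbinomial q (int (?N' + ?M')) (int ?N' + (d + int a - int b))"
    by (rule q_vandermonde) (use q a rN in auto)
  also have "?N' + ?M' = 2 * (s - (r - 1))" using NMs rN rM by linarith
  also have "int ?N' + (d + int a - int b) = int (s - (r - 1)) + int a - int b"
    using NMs rN rM by (simp add: d_def of_nat_diff)
  finally have sum: "(\<Sum>j\<in>{0..int N}. ?t j) =
      qbinomial q (int (2 * (s - (r - 1)))) (int (s - (r - 1)) + int a - int b)" .
  show ?thesis
    unfolding sum_over_sum_range[OF N] summand sum_distrib_left[symmetric] sum by (rule refl)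
qed

text \<open>
  The Andreief identity for two different bases.  Both base changes produce the same sign, so only
  the squared Vandermonde product and a positive constant are left.
\<close>

lemma vandermonde_square_sum:
  "(\<Sum>k\<in>{1..r} \<rightarrow>\<^sub>E sum_range n.
      (vandermonde r (\<lambda>i. q powr (n + k (Suc i))))\<^sup>2 * (\<Prod>i=1..r. weight q m n r (k i))) =
    fact r * (\<Prod>i<r. q powr (2 * (real r - 1) * n - m * n + real i * (m - n) - (real i)\<^sup>2) *
      (qpoch q q i * qpoch q q N * qpoch q q M * qpoch q q (2 * s - (r - 1) - i)) /
      (qpoch q q (N - i) * qpoch q q (M - i) * (qpoch q q (s - i))\<^sup>2))"
proof -
  have NMs: "N + M = 2 * s" using N M s by linarith
  define L where "L = s - (r - 1)"
  have L: "s = L + (r - 1)" unfolding L_def using NMs rN rM by linarith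
  let ?N' = "N - (r - 1)" and ?M' = "M - (r - 1)"
  have nz: "qpoch q q i \<noteq> 0" for i using qpoch_nz[OF q] .
  let ?K = "q powr (2 * (real r - 1) * n - m * n) *
      (qpoch q q N / qpoch q q ?N' * (qpoch q q M / qpoch q q ?M'))"
  let ?V = "\<lambda>k. vandermonde r (\<lambda>i. q powr (n + k (Suc i)))"
  let ?P = "\<Prod>i<r. qpoch q q (N - i) / qpoch q q ?N' * (qpoch q q (M - i) / qpoch q q ?M')"
  let ?S = "\<Sum>k\<in>{1..r} \<rightarrow>\<^sub>E sum_range n. (?V k)\<^sup>2 * (\<Prod>i=1..r. weight q m n r (k i))"
  let ?D1 = "\<lambda>k. Determinant.det (Matrix.mat r r (\<lambda>(i, a).
      poly (basis_poly q r 0 (real N) a) (q powr (n + k (Suc i)))))"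
  let ?D2 = "\<lambda>k. Determinant.det (Matrix.mat r r (\<lambda>(i, b).
      poly (basis_poly q r (m - n) (real s) b) (q powr (n + k (Suc i)))))"
  have EE: "(\<Prod>j<r. (-1) ^ j) * (\<Prod>j<r. (-1) ^ j) = (1::real)"
    by (rule alternating_sign_square)
  have dets: "?D1 k * ?D2 k = (?V k)\<^sup>2 * ?P" for k
  proof -
    have "?D1 k = (\<Prod>j<r. (-1) ^ j) * ?V k * (\<Prod>i<r. qpoch q q (N - i) / qpoch q q ?N')"
      by (rule det_basis_poly[OF q rN]) simp
    moreover have "?D2 k = (\<Prod>j<r. (-1) ^ j) * ?V k * (\<Prod>i<r. qpoch q q (M - i) / qpoch q q ?M')"
      by (rule det_basis_poly[OF q rM]) (use M s in simp)
    moreover have "E * V * A * (E * V * B) = V\<^sup>2 * (A * B)" if "E * E = 1" for E V A B :: real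
    proof -
      have "E * V * A * (E * V * B) = (E * E) * (V\<^sup>2 * (A * B))"
        by (simp only: mult_ac power2_eq_square)
      then show ?thesis by (simp add: that)
    qed
    ultimately show ?thesis using EE by (simp only: prod.distrib)
  qed
  have "?S * ?P = (\<Sum>k\<in>{1..r} \<rightarrow>\<^sub>E sum_range n. ?D1 k * ?D2 k * (\<Prod>i=1..r. weight q m n r (k i)))"
    unfolding dets sum_distrib_right by (intro sum.cong refl) (simp only: mult_ac)
  also have "\<dots> = fact r * Determinant.det (Matrix.mat r r (\<lambda>(a, b).
      \<Sum>k\<in>sum_range n. poly (basis_poly q r 0 (real N) a) (q powr (n + k)) *
      poly (basis_poly q r (m - n) (real s) b) (q powr (n + k)) * weight q m n r k))"
    by (rule andreief[OF finite_sum_range(1)[OF N]])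
  also have "Matrix.mat r r (\<lambda>(a, b).
      \<Sum>k\<in>sum_range n. poly (basis_poly q r 0 (real N) a) (q powr (n + k)) *
      poly (basis_poly q r (m - n) (real s) b) (q powr (n + k)) * weight q m n r k) =
      Matrix.mat r r (\<lambda>(a, b). ?K * q powr (real a * (m - n - real b)) *
      qbinomial q (int (2 * L)) (int L + int a - int b))"
    by (rule eq_matI) (auto simp: moment L_def)
  also have "Determinant.det \<dots> = (\<Prod>i<r. ?K * q powr (real i * (m - n) - (real i)\<^sup>2) * qpoch q q i *
      qpoch q q (2 * L + (r - 1) - i) / (qpoch q q (L + i) * qpoch q q (L + (r - 1 - i))))"
    by (rule det_qbinomial_toeplitz[OF q])
  also have "\<dots> = (\<Prod>i<r. ?K * q powr (real i * (m - n) - (real i)\<^sup>2) * qpoch q q i *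
      qpoch q q (2 * L + (r - 1) - i) / (qpoch q q (s - i))\<^sup>2)"
  proof -
    have s_i: "qpoch q q (L + (r - 1 - i)) = qpoch q q (s - i)" if "i < r" for i
      using that L by simp
    \<comment> \<open>Reversing the order of one of the two products gives the square in the closed form.\<close>
    have "(\<Prod>i<r. qpoch q q (L + i)) = (\<Prod>i<r. qpoch q q (L + (r - Suc i)))"
      by (rule prod.nat_diff_reindex[symmetric])
    also have "\<dots> = (\<Prod>i<r. qpoch q q (s - i))"
      using s_i by (intro prod.cong) auto
    finally have "(\<Prod>i<r. qpoch q q (L + i)) = (\<Prod>i<r. qpoch q q (s - i))" .
    moreover have "(\<Prod>i<r. qpoch q q (L + (r - 1 - i))) = (\<Prod>i<r. qpoch q q (s - i))"
      using s_i by (intro prod.cong) auto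
    ultimately show ?thesis
      by (simp only: prod_dividef prod.distrib power2_eq_square)
  qed
  finally have eq: "?S * ?P = fact r * (\<Prod>i<r. ?K * q powr (real i * (m - n) - (real i)\<^sup>2) *
      qpoch q q i * qpoch q q (2 * L + (r - 1) - i) / (qpoch q q (s - i))\<^sup>2)" .
  have "?P \<noteq> 0" using nz by simp
  then have "?S = fact r * (\<Prod>i<r. ?K * q powr (real i * (m - n) - (real i)\<^sup>2) *
      qpoch q q i * qpoch q q (2 * L + (r - 1) - i) / (qpoch q q (s - i))\<^sup>2) / ?P"
    using eq by (simp add: eq_divide_eq)
  also have "\<dots> = fact r * (\<Prod>i<r. ?K * q powr (real i * (m - n) - (real i)\<^sup>2) *
      qpoch q q i * qpoch q q (2 * L + (r - 1) - i) / (qpoch q q (s - i))\<^sup>2 /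
      (qpoch q q (N - i) / qpoch q q ?N' * (qpoch q q (M - i) / qpoch q q ?M')))"
    by (simp only: prod_dividef times_divide_eq_right)
  also have "\<dots> = fact r * (\<Prod>i<r. q powr (2 * (real r - 1) * n - m * n + real i * (m - n) - (real i)\<^sup>2) *
      (qpoch q q i * qpoch q q N * qpoch q q M * qpoch q q (2 * s - (r - 1) - i)) /
      (qpoch q q (N - i) * qpoch q q (M - i) * (qpoch q q (s - i))\<^sup>2))"
  proof (rule arg_cong[where f = "\<lambda>x. fact r * x"], rule prod.cong[OF refl])
    fix i assume i: "i \<in> {..<r}"
    have 1: "2 * L + (r - 1) - i = 2 * s - (r - 1) - i" using L by simp
    have 2: "q powr (2 * (real r - 1) * n - m * n + real i * (m - n) - (real i)\<^sup>2) =
        q powr (2 * (real r - 1) * n - m * n) * q powr (real i * (m - n) - (real i)\<^sup>2)"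
      by (simp add: algebra_simps flip: powr_add)
    show "?K * q powr (real i * (m - n) - (real i)\<^sup>2) *
      qpoch q q i * qpoch q q (2 * L + (r - 1) - i) / (qpoch q q (s - i))\<^sup>2 /
      (qpoch q q (N - i) / qpoch q q ?N' * (qpoch q q (M - i) / qpoch q q ?M')) =
      q powr (2 * (real r - 1) * n - m * n + real i * (m - n) - (real i)\<^sup>2) *
      (qpoch q q i * qpoch q q N * qpoch q q M * qpoch q q (2 * s - (r - 1) - i)) /
      (qpoch q q (N - i) * qpoch q q (M - i) * (qpoch q q (s - i))\<^sup>2)"
      unfolding 1 2 using nz[of ?N'] nz[of ?M'] by (simp add: mult_ac)
  qed
  finally show ?thesis .
qed

end

section \<open>Values, zeros and poles of the q-Gamma function\<close>

context
  fixes q :: real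
  assumes q: "0 < q" "q < 1"
begin

lemma convergent_prod_qpoch: "convergent_prod (\<lambda>k. 1 - a * q ^ k)"
proof (rule abs_convergent_prod_imp_convergent_prod)
  have "summable (\<lambda>k. \<bar>a\<bar> * q ^ k)"
    using q by (intro summable_mult summable_geometric) auto
  then show "abs_convergent_prod (\<lambda>k. 1 - a * q ^ k)"
    using q by (simp add: abs_convergent_prod_conv_summable abs_mult)
qed

text \<open>
  For \<open>a = 1\<close> the leading factor is zero and the rule for splitting off a non-zero factor
  does not apply; then both sides vanish.
\<close>

lemma qpoch_inf_step: "qpoch_inf a q = (1 - a) * qpoch_inf (a * q) q"
proof (cases "a = 1")
  case True
  have "(0::real) \<in> range (\<lambda>k. 1 - a * q ^ k)"
    using True by (intro image_eqI[of _ _ 0]) auto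
  then have "qpoch_inf a q = 0"
    unfolding qpoch_inf_def
    using has_prod_eq_0_iff[OF convergent_prod_has_prod[OF convergent_prod_qpoch[of a]]] by blast
  then show ?thesis using True by simp
next
  case False
  then have "(\<Prod>k. 1 - a * q ^ Suc k) = qpoch_inf a q / (1 - a)"
    using prodinf_split_head[OF convergent_prod_qpoch[of a]] by (simp add: qpoch_inf_def)
  moreover have "(\<Prod>k. 1 - a * q ^ Suc k) = qpoch_inf (a * q) q"
    by (simp add: qpoch_inf_def mult.assoc)
  ultimately have "qpoch_inf a q / (1 - a) = qpoch_inf (a * q) q" by (simp only:)
  then show ?thesis using False by (simp add: divide_eq_eq mult.commute)
qed

lemma qpoch_inf_split: "qpoch_inf a q = (\<Prod>t<k. 1 - a * q ^ t) * qpoch_inf (a * q ^ k) q"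
proof (induction k)
  case (Suc k)
  have "qpoch_inf (a * q ^ k) q = (1 - a * q ^ k) * qpoch_inf (a * q ^ Suc k) q"
    using qpoch_inf_step[of "a * q ^ k"] by (simp add: mult_ac)
  with Suc show ?case by simp
qed simp

lemma qpoch_inf_nz:
  assumes "0 < a" "a < 1"
  shows "qpoch_inf a q \<noteq> 0"
  unfolding qpoch_inf_def
proof (rule prodinf_nonzero[OF convergent_prod_qpoch])
  fix i
  have "a * q ^ i \<le> a" using assms q by (simp add: mult_left_le power_le_one)
  then show "1 - a * q ^ i \<noteq> 0" using assms by linarith
qed

lemma Gamma_q_of_nat: "Gamma_q q (real k + 1) = qpoch q q k * (1 - q) powr (- real k)"
proof -
  have "(\<Prod>t<k. 1 - q * q ^ t) = qpoch q q k"
    by (induction k) (simp_all add: qpoch_Suc)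
  then have "qpoch_inf q q = qpoch q q k * qpoch_inf (q * q ^ k) q"
    using qpoch_inf_split[of q k] by simp
  moreover have "q powr (real k + 1) = q * q ^ k"
    using q by (simp add: powr_add powr_realpow)
  moreover have "qpoch_inf (q * q ^ k) q \<noteq> 0"
    using q power_Suc_less_one[of q k] by (intro qpoch_inf_nz) auto
  ultimately show ?thesis by (simp add: Gamma_q_def)
qed

lemma Gamma_q_nonpos_Int: "Gamma_q q (- real k) = 0"
proof -
  have "q powr (- real k) * q ^ k = 1"
    using q by (simp add: powr_minus powr_realpow)
  then have "qpoch_inf (q powr (- real k)) q = 0"
    using qpoch_inf_split[of "q powr (- real k)" "Suc k"] by simp
  then show ?thesis by (simp add: Gamma_q_def)
qed

text \<open>
  The partial products converge uniformly on \<open>[-1, 1]\<close>, by comparison with the geometric series.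
\<close>

lemma isCont_qpoch_inf:
  assumes "\<bar>a\<bar> < 1"
  shows "isCont (\<lambda>a. qpoch_inf a q) a"
proof -
  let ?A = "{-1..1::real}"
  have bound: "norm (norm (- x * q ^ n)) \<le> q ^ n" if "x \<in> ?A" for x n
  proof -
    have "\<bar>x\<bar> * q ^ n \<le> 1 * q ^ n" using that q by (intro mult_right_mono) auto
    then show ?thesis using q by (simp add: abs_mult)
  qed
  have sum: "uniformly_convergent_on ?A (\<lambda>N x. \<Sum>n<N. norm (- x * q ^ n))"
    by (rule uniformly_convergentI, rule Weierstrass_m_test[of _ _ "\<lambda>n. q ^ n"])
      (use bound q in \<open>auto intro: summable_geometric\<close>)
  have "uniformly_convergent_on ?A (\<lambda>N x. \<Prod>n<N. 1 + - x * q ^ n)"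
    by (rule uniformly_convergent_on_prod[OF _ _ sum]) (auto intro!: continuous_intros)
  then obtain l where l: "uniform_limit ?A (\<lambda>N x. \<Prod>n<N. 1 - x * q ^ n) l sequentially"
    by (auto simp: uniformly_convergent_on_def)
  have "l x = qpoch_inf x q" if "x \<in> ?A" for x
  proof -
    have "(\<lambda>N. \<Prod>n<N. 1 - x * q ^ n) \<longlonglongrightarrow> l x"
      by (rule tendsto_uniform_limitI[OF l that])
    moreover have "(\<lambda>N. \<Prod>n<N. 1 - x * q ^ n) \<longlonglongrightarrow> qpoch_inf x q"
      using convergent_prod_LIMSEQ[OF convergent_prod_qpoch[of x]]
      by (simp add: qpoch_inf_def LIMSEQ_lessThan_iff_atMost)
    ultimately show ?thesis by (rule LIMSEQ_unique)
  qed
  note limit = this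
  have "continuous_on ?A l"
    by (rule uniform_limit_theorem[OF _ l]) (auto intro!: always_eventually continuous_intros)
  then have "continuous_on ?A (\<lambda>x. qpoch_inf x q)"
    by (rule continuous_on_eq) (rule limit)
  then show ?thesis
    by (rule continuous_on_interior) (use assms in auto)
qed

lemma isCont_Gamma_q:
  assumes "x > 0"
  shows "isCont (Gamma_q q) x"
proof -
  have less: "q powr x < 1" using powr_less_mono'[of q 0 x] q assms by simp
  have 1: "isCont (\<lambda>x. q powr x) x" using q by (intro continuous_intros) auto
  have "isCont (\<lambda>x. qpoch_inf (q powr x) q) x"
    by (rule isCont_o2[OF 1 isCont_qpoch_inf]) (use less in simp)
  moreover have "qpoch_inf (q powr x) q \<noteq> 0"
    using less q by (intro qpoch_inf_nz) auto
  moreover have "Gamma_q q = (\<lambda>x. (1 - q) powr (1 - x) * qpoch_inf q q / qpoch_inf (q powr x) q)"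
    by (rule ext) (simp add: Gamma_q_def)
  ultimately show ?thesis using q by (auto intro!: continuous_intros)
qed

lemma Gamma_q_pos_nz:
  assumes "x > 0"
  shows "Gamma_q q x \<noteq> 0"
proof -
  have "q powr x < 1" using powr_less_mono'[of q 0 x] q assms by simp
  then show ?thesis
    using q qpoch_inf_nz[of q] qpoch_inf_nz[of "q powr x"] by (simp add: Gamma_q_def)
qed

lemma Gamma_q_shift:
  assumes "\<And>t. t < k \<Longrightarrow> x + real t \<noteq> 0"
  shows "Gamma_q q x * (\<Prod>t<k. 1 - q powr (x + real t)) = (1 - q) ^ k * Gamma_q q (x + real k)"
proof -
  have pw: "q powr x * q ^ t = q powr (x + real t)" for t
    using q by (simp add: powr_add powr_realpow)
  have nz: "(\<Prod>t<k. 1 - q powr (x + real t)) \<noteq> 0"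
    using assms q by (auto simp: powr_eq_one_iff_gen)
  have "(1 - q) powr (1 - x) = (1 - q) ^ k * (1 - q) powr (1 - (x + real k))"
    using q by (simp flip: powr_realpow powr_add)
  then show ?thesis
    using qpoch_inf_split[of "q powr x" k] nz by (simp add: Gamma_q_def pw)
qed

text \<open>
  At a non-positive integer the \<open>q\<close>-Gamma function has a simple pole and elsewhere on the integers it
  is finite and non-zero.  The exponent of \<open>\<epsilon>\<close> records this order, so that orders can be added up
  in a product.
\<close>

lemma Gamma_q_order_at_Int:
  fixes c :: int
  assumes "\<kappa> \<noteq> 0"
  shows "\<exists>L. L \<noteq> 0 \<and>
    ((\<lambda>\<epsilon>. Gamma_q q (of_int c + \<kappa> * \<epsilon>) * \<epsilon> ^ (if c \<le> 0 then 1 else 0)) \<longlongrightarrow> L) (at 0)"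
proof (cases "c \<le> 0")
  case False
  have "isCont (\<lambda>\<epsilon>. Gamma_q q (of_int c + \<kappa> * \<epsilon>)) 0"
    by (rule isCont_o2[where g = "Gamma_q q"], intro continuous_intros, rule isCont_Gamma_q)
      (use False in auto)
  then have "((\<lambda>\<epsilon>. Gamma_q q (of_int c + \<kappa> * \<epsilon>)) \<longlongrightarrow> Gamma_q q (of_int c)) (at 0)"
    by (simp add: isCont_def)
  moreover have "Gamma_q q (of_int c) \<noteq> 0"
    using False by (intro Gamma_q_pos_nz) auto
  ultimately show ?thesis using False by auto
next
  case True
  define k where "k = nat (- c)"
  have c: "real_of_int c = - real k" using True by (simp add: k_def)
  \<comment> \<open>Shift the argument \<open>-k + \<kappa>\<epsilon>\<close> to \<open>1 + \<kappa>\<epsilon>\<close>.  Only the factor \<open>1 - q\<^bsup>\<kappa>\<epsilon>\<^esup>\<close> tends to 0, with slope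
    \<open>-\<kappa> ln q\<close>.\<close>
  define F where "F \<epsilon> = (1 - q) ^ Suc k * Gamma_q q (1 + \<kappa> * \<epsilon>) /
      ((\<Prod>t<k. 1 - q powr (of_int c + \<kappa> * \<epsilon> + real t)) * ((1 - q powr (\<kappa> * \<epsilon>)) / \<epsilon>))" for \<epsilon>
  define L where "L = (1 - q) ^ Suc k * Gamma_q q 1 /
      ((\<Prod>t<k. 1 - q powr (of_int c + \<kappa> * 0 + real t)) * - (\<kappa> * ln q))"
  have lim1: "((\<lambda>\<epsilon>. Gamma_q q (1 + \<kappa> * \<epsilon>)) \<longlongrightarrow> Gamma_q q 1) (at 0)"
  proof -
    have "isCont (\<lambda>\<epsilon>. Gamma_q q (1 + \<kappa> * \<epsilon>)) 0"
      by (rule isCont_o2[where g = "Gamma_q q"], intro continuous_intros, rule isCont_Gamma_q) auto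
    then show ?thesis by (simp add: isCont_def)
  qed
  have lim2: "((\<lambda>\<epsilon>. (1 - q powr (\<kappa> * \<epsilon>)) / \<epsilon>) \<longlongrightarrow> - (\<kappa> * ln q)) (at 0)"
  proof -
    have "((\<lambda>\<epsilon>. 1 - q powr (\<kappa> * \<epsilon>)) has_real_derivative - (\<kappa> * ln q)) (at 0)"
      using q by (auto intro!: derivative_eq_intros)
    then show ?thesis using q by (simp add: has_field_derivative_iff)
  qed
  have lim3: "((\<lambda>\<epsilon>. \<Prod>t<k. 1 - q powr (of_int c + \<kappa> * \<epsilon> + real t)) \<longlongrightarrow>
      (\<Prod>t<k. 1 - q powr (of_int c + \<kappa> * 0 + real t))) (at 0)"
    using q by (intro tendsto_intros) auto
  have nz3: "(\<Prod>t<k. 1 - q powr (of_int c + \<kappa> * 0 + real t)) \<noteq> 0"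
    using q c by (auto simp: powr_eq_one_iff_gen)
  have nz2: "\<kappa> * ln q \<noteq> 0" using assms q by simp
  have "(F \<longlongrightarrow> L) (at 0)"
    unfolding F_def L_def using nz2 nz3 by (intro tendsto_divide tendsto_mult tendsto_const lim1 lim2 lim3) auto
  moreover have "\<forall>\<^sub>F \<epsilon> in at 0. F \<epsilon> = Gamma_q q (of_int c + \<kappa> * \<epsilon>) * \<epsilon>"
  proof -
    have "\<forall>\<^sub>F \<epsilon> in at 0. \<bar>\<kappa> * \<epsilon>\<bar> < 1"
    proof -
      have "((\<lambda>\<epsilon>. \<bar>\<kappa> * \<epsilon>\<bar>) \<longlongrightarrow> \<bar>\<kappa> * 0\<bar>) (at 0)" by (intro tendsto_intros)
      then show ?thesis by (rule order_tendstoD) simp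
    qed
    moreover have "\<forall>\<^sub>F \<epsilon> in at 0. \<epsilon> \<noteq> (0::real)" by (simp add: eventually_at_filter)
    ultimately show ?thesis
    proof eventually_elim
      case (elim \<epsilon>)
      have ne: "of_int c + \<kappa> * \<epsilon> + real t \<noteq> 0" for t
      proof
        assume "of_int c + \<kappa> * \<epsilon> + real t = 0"
        then have e: "\<kappa> * \<epsilon> = of_int (int k - int t)" using c by simp
        with elim(1) have "\<bar>int k - int t\<bar> < 1" by linarith
        then have "\<kappa> * \<epsilon> = 0" using e by simp
        then show False using assms elim(2) by simp
      qed
      have nz: "(\<Prod>t<k. 1 - q powr (of_int c + \<kappa> * \<epsilon> + real t)) \<noteq> 0"
        using ne q by (auto simp: powr_eq_one_iff_gen)
      have nz': "1 - q powr (\<kappa> * \<epsilon>) \<noteq> 0"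
        using assms elim q by (simp add: powr_eq_one_iff_gen)
      have arg: "of_int c + \<kappa> * \<epsilon> + real (Suc k) = 1 + \<kappa> * \<epsilon>"
        "of_int c + \<kappa> * \<epsilon> + real k = \<kappa> * \<epsilon>" using c by simp_all
      have shift: "Gamma_q q (of_int c + \<kappa> * \<epsilon>) *
          ((\<Prod>t<k. 1 - q powr (of_int c + \<kappa> * \<epsilon> + real t)) * (1 - q powr (\<kappa> * \<epsilon>))) =
          (1 - q) ^ Suc k * Gamma_q q (1 + \<kappa> * \<epsilon>)"
        using Gamma_q_shift[OF ne, of "Suc k"] unfolding arg prod.lessThan_Suc .
      show ?case
        unfolding F_def shift[symmetric] using nz nz' elim(2) by simp
    qed
  qed
  ultimately have "((\<lambda>\<epsilon>. Gamma_q q (of_int c + \<kappa> * \<epsilon>) * \<epsilon>) \<longlongrightarrow> L) (at 0)"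
    by (rule Lim_transform_eventually)
  moreover have "L \<noteq> 0"
    using Gamma_q_pos_nz[of 1] nz2 nz3 q by (simp add: L_def)
  ultimately show ?thesis using True by auto
qed

end

section \<open>From the multiple sum to the closed form\<close>

lemma prod_pairs:
  fixes f :: "nat \<Rightarrow> nat \<Rightarrow> 'a::comm_monoid_mult"
  shows "(\<Prod>(i, j)\<in>{(i, j). 1 \<le> i \<and> i < j \<and> j \<le> r}. f i j) =
    (\<Prod>j<r. \<Prod>i<j. f (Suc i) (Suc j))"
proof -
  have "(\<Prod>j<r. \<Prod>i<j. f (Suc i) (Suc j)) =
      (\<Prod>(j, i)\<in>Sigma {..<r} (\<lambda>j. {..<j}). f (Suc i) (Suc j))"
    by (rule prod.Sigma) auto
  also have "\<dots> = (\<Prod>(i, j)\<in>{(i, j). 1 \<le> i \<and> i < j \<and> j \<le> r}. f i j)"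
    by (rule prod.reindex_bij_witness[of _ "\<lambda>(i, j). (j - 1, i - 1)" "\<lambda>(j, i). (Suc i, Suc j)"]) auto
  finally show ?thesis ..
qed

lemma prod_1_upto: "(\<Prod>i=1..r. h i) = (\<Prod>i<r. h (Suc i))"
  by (simp add: prod.shift_bounds_Suc_ivl[symmetric] atLeastLessThanSuc_atLeastAtMost
      flip: atLeast0LessThan)

lemma sum_lessThan_real: "(\<Sum>i<r. real i) = real r * (real r - 1) / 2"
  by (induction r) (auto simp: field_simps)

lemma sum_lessThan_real_sq: "(\<Sum>i<r. (real i)\<^sup>2) = real r * (real r - 1) * (2 * real r - 1) / 6"
  by (induction r) (auto simp: field_simps power2_eq_square)

definition summand :: "real \<Rightarrow> nat \<Rightarrow> real \<Rightarrow> real \<Rightarrow> (nat \<Rightarrow> real) \<Rightarrow> real" where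
  "summand q r m n k =
    (\<Prod>(i, j)\<in>{(i, j). 1 \<le> i \<and> i < j \<and> j \<le> r}. (qnumber q (k j - k i))\<^sup>2) *
    (\<Prod>i=1..r. q powr ((k i)\<^sup>2 + (m + n - 2 * real i + 2) * k i) *
       qbinomial q \<lfloor>2 * n\<rfloor> \<lfloor>n + k i\<rfloor> * qbinomial q \<lfloor>2 * m\<rfloor> \<lfloor>m + k i\<rfloor>)"

text \<open>
  From \<open>[k\<^sub>j - k\<^sub>i]\<^sup>2 = q\<^bsup>-2(n + k\<^sub>i)\<^esup> (y\<^sub>j - y\<^sub>i)\<^sup>2 / (1 - q)\<^sup>2\<close> the variable \<open>k\<^sub>i\<close> collects, over all \<open>j > i\<close>,
  the power \<open>q\<^bsup>-2(r - i) k\<^sub>i\<^esup>\<close>.  Together with \<open>q\<^bsup>(2 - 2i) k\<^sub>i\<^esup>\<close> this is \<open>q\<^bsup>(2 - 2r) k\<^sub>i\<^esup>\<close>, independent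
  of the position \<open>i\<close>.
\<close>

lemma summand_eq_vandermonde:
  assumes q: "0 < q" "q < 1"
  shows "summand q r m n k =
    (\<Prod>i<r. q powr (- 2 * n * (real r - 1 - real i)) * (1 - q) powr (- 2 * (real r - 1 - real i))) *
    ((vandermonde r (\<lambda>i. q powr (n + k (Suc i))))\<^sup>2 * (\<Prod>i=1..r. weight q m n r (k i)))"
proof -
  define g where "g i = q powr (- 2 * (n + k (Suc i))) * (1 - q) powr (- 2)" for i
  define h where "h i = q powr ((k (Suc i))\<^sup>2 + (m + n - 2 * real (Suc i) + 2) * k (Suc i))" for i
  define b where "b i = qbinomial q \<lfloor>2 * n\<rfloor> \<lfloor>n + k (Suc i)\<rfloor> * qbinomial q \<lfloor>2 * m\<rfloor> \<lfloor>m + k (Suc i)\<rfloor>" for i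
  let ?y = "\<lambda>i. q powr (n + k (Suc i))"
  have pair: "(qnumber q (k (Suc j) - k (Suc i)))\<^sup>2 = (?y j - ?y i)\<^sup>2 * g i" for i j
  proof -
    have "q powr (k (Suc j) - k (Suc i)) = ?y j / ?y i" by (simp flip: powr_diff)
    then have "(qnumber q (k (Suc j) - k (Suc i)))\<^sup>2 = (?y j - ?y i)\<^sup>2 / ((?y i)\<^sup>2 * (1 - q)\<^sup>2)"
      using q by (simp add: qnumber_def divide_simps) (simp add: power2_eq_square algebra_simps)
    moreover have "1 / (?y i)\<^sup>2 = q powr (- 2 * (n + k (Suc i)))"
    proof -
      have "(?y i)\<^sup>2 = q powr (2 * (n + k (Suc i)))"
        unfolding power2_eq_square powr_add[symmetric] by (simp only: mult_2)
      then show ?thesis by (simp only: powr_minus_divide mult_minus_left)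
    qed
    moreover have "1 / (1 - q)\<^sup>2 = (1 - q) powr (- 2)"
      using q by (simp add: powr_minus_divide)
    ultimately show ?thesis unfolding g_def
      by (metis (no_types, opaque_lifting) divide_divide_eq_left times_divide_eq_right mult.right_neutral)
  qed
  have "(\<Prod>(i, j)\<in>{(i, j). 1 \<le> i \<and> i < j \<and> j \<le> r}. (qnumber q (k j - k i))\<^sup>2) =
      (\<Prod>j<r. \<Prod>i<j. (?y j - ?y i)\<^sup>2 * g i)"
    by (simp only: prod_pairs pair)
  also have "\<dots> = (vandermonde r ?y)\<^sup>2 * (\<Prod>i<r. g i ^ (r - 1 - i))"
    by (simp only: prod.distrib prod_triangle vandermonde_def prod_power_distrib)
  finally have pairs: "(\<Prod>(i, j)\<in>{(i, j). 1 \<le> i \<and> i < j \<and> j \<le> r}. (qnumber q (k j - k i))\<^sup>2) =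
      (vandermonde r ?y)\<^sup>2 * (\<Prod>i<r. g i ^ (r - 1 - i))" .
  have single: "g i ^ (r - 1 - i) * (h i * b i) =
      q powr (- 2 * n * (real r - 1 - real i)) * (1 - q) powr (- 2 * (real r - 1 - real i)) *
      weight q m n r (k (Suc i))" if "i < r" for i
  proof -
    have e: "real (r - 1 - i) = real r - 1 - real i" using that by simp
    have "g i ^ (r - 1 - i) = q powr (- 2 * (n + k (Suc i)) * (real r - 1 - real i)) *
        (1 - q) powr (- 2 * (real r - 1 - real i))"
    proof -
      have "(x powr a) ^ (r - 1 - i) = x powr (a * real (r - 1 - i))" if "x > 0" for x a :: real
        using that by (simp add: powr_powr flip: powr_realpow)
      then show ?thesis using q unfolding g_def power_mult_distrib e by simp
    qed
    then have "g i ^ (r - 1 - i) * (h i * b i) =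
        (q powr (- 2 * (n + k (Suc i)) * (real r - 1 - real i)) * h i) *
        (1 - q) powr (- 2 * (real r - 1 - real i)) * b i"
      by (simp only: mult_ac)
    also have "q powr (- 2 * (n + k (Suc i)) * (real r - 1 - real i)) * h i =
        q powr (- 2 * n * (real r - 1 - real i)) *
        q powr ((k (Suc i))\<^sup>2 + (m + n - 2 * real r + 2) * k (Suc i))"
      unfolding h_def powr_add[symmetric]
      by (rule arg_cong[where f = "\<lambda>x. q powr x"]) (simp add: algebra_simps)
    finally show ?thesis
      unfolding weight_def b_def by (simp only: mult_ac)
  qed
  have "summand q r m n k = (vandermonde r ?y)\<^sup>2 * (\<Prod>i<r. g i ^ (r - 1 - i) * (h i * b i))"
    unfolding summand_def pairs prod_1_upto h_def b_def prod.distrib by (simp only: mult_ac)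
  also have "(\<Prod>i<r. g i ^ (r - 1 - i) * (h i * b i)) =
      (\<Prod>i<r. q powr (- 2 * n * (real r - 1 - real i)) * (1 - q) powr (- 2 * (real r - 1 - real i)) *
      weight q m n r (k (Suc i)))"
    by (intro prod.cong refl single) simp
  finally show ?thesis unfolding prod_1_upto prod.distrib by (simp only: mult_ac)
qed

context
  fixes q m n :: real and r N M s :: nat
  assumes q: "0 < q" "q < 1" and r: "r \<ge> 1"
    and N: "2 * n = real N" and M: "2 * m = real M" and s: "m + n = real s"
begin

text \<open>
  The range of \<open>r\<close> in which every \<open>q\<close>-Gamma value is a \<open>q\<close>-factorial times
  a power of \<open>1 - q\<close>.  The powers of \<open>q\<close> and of
  \<open>1 - q\<close> agree only after multiplication over all \<open>i\<close>, not factor by factor.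
\<close>

lemma sum_summand_eq_rhs:
  assumes rN: "r - 1 \<le> N" and rM: "r - 1 \<le> M"
  shows "(\<Sum>k\<in>{1..r} \<rightarrow>\<^sub>E sum_range n. summand q r m n k) = rhs q r m n"
proof -
  let ?R = "\<lambda>i. (qpoch q q i * qpoch q q N * qpoch q q M * qpoch q q (2 * s - (r - 1) - i)) /
      (qpoch q q (N - i) * qpoch q q (M - i) * (qpoch q q (s - i))\<^sup>2)"
  have NMs: "N + M = 2 * s" using N M s by linarith
  have Gam: "Gamma_q q (real (Suc i)) * Gamma_q q (2 * n + 1) * Gamma_q q (2 * m + 1) *
      Gamma_q q (2 * m + 2 * n - real r - real (Suc i) + 3) /
      (Gamma_q q (2 * n - real (Suc i) + 2) * Gamma_q q (2 * m - real (Suc i) + 2) *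
      (Gamma_q q (m + n - real (Suc i) + 2))\<^sup>2) = ?R i * (1 - q) powr (real r - 1 - 4 * real i)"
    if i: "i < r" for i
  proof -
    have a: "real (Suc i) = real i + 1" "2 * n + 1 = real N + 1" "2 * m + 1 = real M + 1"
      "2 * m + 2 * n - real r - real (Suc i) + 3 = real (2 * s - (r - 1) - i) + 1"
      "2 * n - real (Suc i) + 2 = real (N - i) + 1"
      "2 * m - real (Suc i) + 2 = real (M - i) + 1"
      "m + n - real (Suc i) + 2 = real (s - i) + 1"
    proof -
      have "i \<le> N" "i \<le> M" "i \<le> s" "r - 1 \<le> 2 * s" "i \<le> 2 * s - (r - 1)"
        using i rN rM NMs by linarith+
      then show "2 * m + 2 * n - real r - real (Suc i) + 3 = real (2 * s - (r - 1) - i) + 1"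
        "2 * n - real (Suc i) + 2 = real (N - i) + 1"
        "2 * m - real (Suc i) + 2 = real (M - i) + 1"
        "m + n - real (Suc i) + 2 = real (s - i) + 1"
        using s N M r by (simp_all add: of_nat_diff algebra_simps)
    qed (use N M in simp_all)
    let ?p = "\<lambda>k::nat. (1 - q) powr (- real k)"
    have p: "?p i * ?p N * ?p M * ?p (2 * s - (r - 1) - i) =
        (?p (N - i) * ?p (M - i) * (?p (s - i))\<^sup>2) * (1 - q) powr (real r - 1 - 4 * real i)"
    proof -
      have "i \<le> N" "i \<le> M" "i \<le> s" "r - 1 \<le> 2 * s" "i \<le> 2 * s - (r - 1)"
        using i rN rM NMs by linarith+
      then have "- real i + - real N + - real M + - real (2 * s - (r - 1) - i) =
          - real (N - i) + - real (M - i) + (- real (s - i) + - real (s - i)) + (real r - 1 - 4 * real i)"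
        using r by (simp add: of_nat_diff)
      then show ?thesis unfolding power2_eq_square powr_add[symmetric] by (simp only:)
    qed
    have nz: "?p k \<noteq> 0" for k using q by simp
    have "(A * a) * (B * b) * (C * c) * (D * d) / ((E * e) * (F * f) * (G * g)\<^sup>2) =
        A * B * C * D / (E * F * G\<^sup>2) * P"
      if "a * b * c * d = (e * f * g\<^sup>2) * P" "e \<noteq> 0" "f \<noteq> 0" "g \<noteq> 0"
      for A B C D E F G P a b c d e f g :: real
    proof -
      have "(A * a) * (B * b) * (C * c) * (D * d) / ((E * e) * (F * f) * (G * g)\<^sup>2) =
          (A * B * C * D) * (a * b * c * d) / ((E * F * G\<^sup>2) * (e * f * g\<^sup>2))"
        by (simp only: power_mult_distrib mult_ac)
      also have "\<dots> = A * B * C * D / (E * F * G\<^sup>2) * P"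
        unfolding that(1) using that(2-) by simp
      finally show ?thesis .
    qed
    from this[OF p nz nz nz] show ?thesis
      unfolding a(2-7) unfolding a(1) Gamma_q_of_nat[OF q] .
  qed
  let ?E = "- real r * m * n - real r * (real r - 1) * (2 * real r - 3 * m - 3 * n - 1) / 6"
  have rhs: "rhs q r m n = fact r * q powr ?E * (\<Prod>i<r. ?R i * (1 - q) powr (real r - 1 - 4 * real i))"
    unfolding rhs_def prod_1_upto 
    by (rule arg_cong2[where f = "(*)", OF refl], rule prod.cong[OF refl], rule Gam, simp)
  let ?c = "\<lambda>i. q powr (- 2 * n * (real r - 1 - real i)) * (1 - q) powr (- 2 * (real r - 1 - real i))"
  let ?d = "\<lambda>i. q powr (2 * (real r - 1) * n - m * n + real i * (m - n) - (real i)\<^sup>2)"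
  have cd: "(\<Prod>i<r. ?c i * ?d i) = q powr ?E * (\<Prod>i<r. (1 - q) powr (real r - 1 - 4 * real i))"
  proof -
    have "(\<Prod>i<r. ?c i * ?d i) = (\<Prod>i<r. q powr (- m * n + (m + n) * real i - (real i)\<^sup>2)) *
        (\<Prod>i<r. (1 - q) powr (- 2 * (real r - 1) + 2 * real i))"
      unfolding prod.distrib[symmetric]
    proof (rule prod.cong[OF refl])
      fix i
      have "?c i * ?d i = (q powr (- 2 * n * (real r - 1 - real i)) * ?d i) *
          (1 - q) powr (- 2 * (real r - 1 - real i))"
        by (simp only: mult_ac)
      also have "q powr (- 2 * n * (real r - 1 - real i)) * ?d i =
          q powr (- m * n + (m + n) * real i - (real i)\<^sup>2)"
        unfolding powr_add[symmetric]
        by (rule arg_cong[where f = "\<lambda>x. q powr x"]) (simp add: algebra_simps)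
      also have "q powr (- m * n + (m + n) * real i - (real i)\<^sup>2) *
          (1 - q) powr (- 2 * (real r - 1 - real i)) =
          q powr (- m * n + (m + n) * real i - (real i)\<^sup>2) *
          (1 - q) powr (- 2 * (real r - 1) + 2 * real i)"
        by (simp add: algebra_simps)
      finally show "?c i * ?d i = q powr (- m * n + (m + n) * real i - (real i)\<^sup>2) *
          (1 - q) powr (- 2 * (real r - 1) + 2 * real i)" .
    qed
    also have "(\<Prod>i<r. q powr (- m * n + (m + n) * real i - (real i)\<^sup>2)) =
        q powr (\<Sum>i<r. - m * n + (m + n) * real i - (real i)\<^sup>2)"
      by (rule powr_sum[symmetric]) (use q in auto)
    also have "(\<Sum>i<r. - m * n + (m + n) * real i - (real i)\<^sup>2) =
        real r * (- m * n) + (m + n) * (\<Sum>i<r. real i) - (\<Sum>i<r. (real i)\<^sup>2)"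
      by (simp add: sum.distrib sum_subtractf sum_distrib_left)
    also have "\<dots> = ?E"
      unfolding sum_lessThan_real sum_lessThan_real_sq by (simp add: field_simps)
    also have "(\<Prod>i<r. (1 - q) powr (- 2 * (real r - 1) + 2 * real i)) =
        (1 - q) powr (\<Sum>i<r. - 2 * (real r - 1) + 2 * real i)"
      by (rule powr_sum[symmetric]) (use q in auto)
    also have "(\<Sum>i<r. - 2 * (real r - 1) + 2 * real i) =
        real r * (- 2 * (real r - 1)) + 2 * (\<Sum>i<r. real i)"
      by (simp add: sum.distrib sum_distrib_left)
    also have "\<dots> = real r * (real r - 1) - 4 * (\<Sum>i<r. real i)"
      unfolding sum_lessThan_real by (simp add: field_simps)
    also have "\<dots> = (\<Sum>i<r. real r - 1 - 4 * real i)"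
      by (simp add: sum_subtractf sum_distrib_left)
    also have "(1 - q) powr \<dots> = (\<Prod>i<r. (1 - q) powr (real r - 1 - 4 * real i))"
      by (rule powr_sum) (use q in auto)
    finally show ?thesis .
  qed
  have "(\<Sum>k\<in>{1..r} \<rightarrow>\<^sub>E sum_range n. summand q r m n k) =
      (\<Prod>i<r. ?c i) * (\<Sum>k\<in>{1..r} \<rightarrow>\<^sub>E sum_range n.
        (vandermonde r (\<lambda>i. q powr (n + k (Suc i))))\<^sup>2 * (\<Prod>i=1..r. weight q m n r (k i)))"
    unfolding sum_distrib_left by (intro sum.cong refl) (rule summand_eq_vandermonde[OF q])
  also have "\<dots> = (\<Prod>i<r. ?c i) * (fact r * (\<Prod>i<r. ?d i *
      (qpoch q q i * qpoch q q N * qpoch q q M * qpoch q q (2 * s - (r - 1) - i)) /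
      (qpoch q q (N - i) * qpoch q q (M - i) * (qpoch q q (s - i))\<^sup>2)))"
    by (subst vandermonde_square_sum[OF q r N M s rN rM]) (rule refl)
  also have "\<dots> = fact r * (\<Prod>i<r. ?c i * ?d i) * (\<Prod>i<r. ?R i)"
    unfolding times_divide_eq_right[symmetric] prod.distrib by (simp only: mult_ac)
  also have "\<dots> = rhs q r m n"
    unfolding cd unfolding rhs prod.distrib by (simp only: mult_ac)
  finally show ?thesis .
qed

text \<open>
  Either two of the \<open>k\<^sub>i\<close> coincide, or there are too many of them for \<open>[-n, n]\<close>, or one lies
  outside \<open>[-m, m]\<close>.
\<close>

lemma summand_eq_0:
  assumes big: "N + 1 < r \<or> M + 1 < r" and k: "k \<in> {1..r} \<rightarrow>\<^sub>E sum_range n"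
  shows "summand q r m n k = 0"
proof (cases "inj_on k {1..r}")
  case False
  then obtain a b where ab: "a \<in> {1..r}" "b \<in> {1..r}" "a \<noteq> b" "k a = k b"
    unfolding inj_on_def by blast
  define i j where "i = min a b" and "j = max a b"
  have ij: "i \<in> {1..r}" "j \<in> {1..r}" "i < j" "k i = k j"
    using ab unfolding i_def j_def by (auto simp: min_def max_def)
  have "finite {(i, j). 1 \<le> i \<and> i < j \<and> j \<le> r}"
    by (rule finite_subset[of _ "{..r} \<times> {..r}"]) auto
  then have "(\<Prod>(i, j)\<in>{(i, j). 1 \<le> i \<and> i < j \<and> j \<le> r}. (qnumber q (k j - k i))\<^sup>2) = 0"
    using ij q by (intro prod_zero bexI[of _ "(i, j)"]) (auto simp: qnumber_def)
  then show ?thesis by (simp add: summand_def)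
next
  case True
  then have card: "card (k ` {1..r}) = r" by (simp add: card_image)
  have "k ` {1..r} \<subseteq> sum_range n" using k by auto
  then have "card (k ` {1..r}) \<le> card (sum_range n)"
    by (rule card_mono[OF finite_sum_range(1)[OF N]])
  then have "r \<le> card (sum_range n)" by (simp only: card)
  then have "r \<le> N + 1" using finite_sum_range(2)[OF N] by simp
  then have "M + 1 < r" using big by simp
  have "\<not> k ` {1..r} \<subseteq> sum_range m"
  proof
    assume "k ` {1..r} \<subseteq> sum_range m"
    then have "card (k ` {1..r}) \<le> card (sum_range m)"
      by (rule card_mono[OF finite_sum_range(1)[OF M]])
    then have "r \<le> card (sum_range m)" by (simp only: card)
    then show False using finite_sum_range(2)[OF M] \<open>M + 1 < r\<close> by linarith
  qed
  then obtain i where i: "i \<in> {1..r}" "k i \<notin> sum_range m"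
    unfolding image_subset_iff by blast
  have "k i \<in> sum_range n" using k i by auto
  then obtain z where z: "k i - n = of_int z" by (auto simp: sum_range_def elim: Ints_cases)
  have mk: "m + k i = of_int (z + int s)" using z s by simp
  have "k i - m = of_int (z + int s - int M)" using mk M by simp
  then have "k i - m \<in> \<int>" by (metis Ints_of_int)
  then have "m + k i < 0 \<or> m + k i > real M" using i M by (auto simp: sum_range_def)
  then have "z + int s < 0 \<or> z + int s > int M" unfolding mk by linarith
  then have "qbinomial q \<lfloor>2 * m\<rfloor> \<lfloor>m + k i\<rfloor> = 0"
    unfolding mk M floor_of_int floor_of_nat by (auto simp: qbinomial_def)
  then have "(\<Prod>i=1..r. q powr ((k i)\<^sup>2 + (m + n - 2 * real i + 2) * k i) *
       qbinomial q \<lfloor>2 * n\<rfloor> \<lfloor>n + k i\<rfloor> * qbinomial q \<lfloor>2 * m\<rfloor> \<lfloor>m + k i\<rfloor>) = 0"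
    using i(1) by (intro prod_zero) auto
  then show ?thesis by (simp add: summand_def)
qed

text \<open>
  The factor with \<open>i = 2n + 2\<close> or \<open>i = 2m + 2\<close> contains \<open>1 / \<Gamma>\<^sub>q(0)\<close>.
\<close>

lemma rhs_eq_0:
  assumes "N + 1 < r \<or> M + 1 < r"
  shows "rhs q r m n = 0"
proof -
  have Gam0: "Gamma_q q 0 = 0" using Gamma_q_nonpos_Int[OF q, of 0] by simp
  have "\<exists>i\<in>{1..r}. Gamma_q q (2 * n - real i + 2) * Gamma_q q (2 * m - real i + 2) = 0"
  proof (cases "N + 1 < r")
    case True
    then show ?thesis using N Gam0 by (intro bexI[of _ "N + 2"]) auto
  next
    case False
    then show ?thesis using assms M Gam0 by (intro bexI[of _ "M + 2"]) auto
  qed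
  then show ?thesis unfolding rhs_def by (auto simp: prod_zero_iff)
qed

lemma rhs_has_pole_imp: "s + 2 \<le> r" if "rhs_has_pole r m n"
proof -
  from that obtain i x where ix: "i \<in> {1..r}" "x \<in> nonpos_Ints"
    "x \<in> {real i, 2 * n + 1, 2 * m + 1, 2 * m + 2 * n - real r - real i + 3}"
    unfolding rhs_has_pole_def by blast
  have "x \<le> 0" using ix(2) by (auto elim: nonpos_Ints_cases)
  with ix N M have "2 * m + 2 * n - real r - real i + 3 \<le> 0" by auto
  then show ?thesis using s ix(1) by auto
qed

text \<open>
  The numerator poles are at most \<open>2(r - s - 1)\<close> in number, which is the number of zeros of
  \<open>1 / \<Gamma>\<^sub>q(m + n - i + 2)\<^sup>2\<close> counted with multiplicity.  Since \<open>r \<ge> s + 2\<close> forces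
  \<open>r \<ge> 2n + 2\<close> or \<open>r \<ge> 2m + 2\<close>, the remaining denominator factors contribute at least one further zero.
\<close>

lemma rhs_tendsto_0:
  assumes big: "s + 2 \<le> r"
  shows "((\<lambda>\<epsilon>. rhs q r (m + \<epsilon>) (n + \<epsilon>)) \<longlongrightarrow> 0) (at 0)"
proof -
  define p :: "int \<Rightarrow> nat" where "p c = (if c \<le> 0 then 1 else 0)" for c
  define c1 where "c1 i = 2 * int s - int r - int i + 3" for i :: nat
  define c2 where "c2 i = int N - int i + 2" for i :: nat
  define c3 where "c3 i = int M - int i + 2" for i :: nat
  define c4 where "c4 i = int s - int i + 2" for i :: nat
  have NMs: "N + M = 2 * s" using N M s by linarith
  \<comment> \<open>\<open>c1\<close>, ..., \<open>c4\<close> are the arguments at \<open>\<epsilon> = 0\<close>; \<open>T\<close> is the \<open>i\<close>-th factor and \<open>U\<close> is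
    \<open>T\<close> with its power of \<open>\<epsilon>\<close> removed.\<close>
  define T where "T i \<epsilon> = Gamma_q q (real i) * Gamma_q q (2 * (n + \<epsilon>) + 1) *
      Gamma_q q (2 * (m + \<epsilon>) + 1) * Gamma_q q (2 * (m + \<epsilon>) + 2 * (n + \<epsilon>) - real r - real i + 3) /
      (Gamma_q q (2 * (n + \<epsilon>) - real i + 2) * Gamma_q q (2 * (m + \<epsilon>) - real i + 2) *
        (Gamma_q q (m + \<epsilon> + (n + \<epsilon>) - real i + 2))\<^sup>2)" for i \<epsilon>
  define U where "U i \<epsilon> = T i \<epsilon> * \<epsilon> ^ p (c1 i) / \<epsilon> ^ (p (c2 i) + p (c3 i) + 2 * p (c4 i))" for i \<epsilon>
  have ord: "\<exists>L. L \<noteq> 0 \<and> ((\<lambda>\<epsilon>. Gamma_q q (f \<epsilon>) * \<epsilon> ^ p c) \<longlongrightarrow> L) (at 0)"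
    if "\<kappa> \<noteq> 0" "\<And>\<epsilon>. f \<epsilon> = of_int c + \<kappa> * \<epsilon>" for f c \<kappa>
    using Gamma_q_order_at_Int[OF q that(1), of c] by (simp add: that(2) p_def cong: if_cong)
  have U: "\<exists>L. (U i \<longlongrightarrow> L) (at 0)" for i
  proof -
    obtain L1 where L1: "((\<lambda>\<epsilon>. Gamma_q q (2 * (m + \<epsilon>) + 2 * (n + \<epsilon>) - real r - real i + 3) *
        \<epsilon> ^ p (c1 i)) \<longlongrightarrow> L1) (at 0)"
      using ord[of 4 "\<lambda>\<epsilon>. 2 * (m + \<epsilon>) + 2 * (n + \<epsilon>) - real r - real i + 3" "c1 i"] s
      by (auto simp: c1_def algebra_simps)
    obtain L2 where L2: "L2 \<noteq> 0"
      "((\<lambda>\<epsilon>. Gamma_q q (2 * (n + \<epsilon>) - real i + 2) * \<epsilon> ^ p (c2 i)) \<longlongrightarrow> L2) (at 0)"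
      using ord[of 2 "\<lambda>\<epsilon>. 2 * (n + \<epsilon>) - real i + 2" "c2 i"] N by (auto simp: c2_def algebra_simps)
    obtain L3 where L3: "L3 \<noteq> 0"
      "((\<lambda>\<epsilon>. Gamma_q q (2 * (m + \<epsilon>) - real i + 2) * \<epsilon> ^ p (c3 i)) \<longlongrightarrow> L3) (at 0)"
      using ord[of 2 "\<lambda>\<epsilon>. 2 * (m + \<epsilon>) - real i + 2" "c3 i"] M by (auto simp: c3_def algebra_simps)
    obtain L4 where L4: "L4 \<noteq> 0"
      "((\<lambda>\<epsilon>. Gamma_q q (m + \<epsilon> + (n + \<epsilon>) - real i + 2) * \<epsilon> ^ p (c4 i)) \<longlongrightarrow> L4) (at 0)"
      using ord[of 2 "\<lambda>\<epsilon>. m + \<epsilon> + (n + \<epsilon>) - real i + 2" "c4 i"] s by (auto simp: c4_def algebra_simps)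
    obtain L5 where L5: "((\<lambda>\<epsilon>. Gamma_q q (2 * (n + \<epsilon>) + 1)) \<longlongrightarrow> L5) (at 0)"
      using ord[of 2 "\<lambda>\<epsilon>. 2 * (n + \<epsilon>) + 1" "int N + 1"] N by (auto simp: p_def)
    obtain L6 where L6: "((\<lambda>\<epsilon>. Gamma_q q (2 * (m + \<epsilon>) + 1)) \<longlongrightarrow> L6) (at 0)"
      using ord[of 2 "\<lambda>\<epsilon>. 2 * (m + \<epsilon>) + 1" "int M + 1"] M by (auto simp: p_def)
    have "U i = (\<lambda>\<epsilon>. Gamma_q q (real i) * Gamma_q q (2 * (n + \<epsilon>) + 1) * Gamma_q q (2 * (m + \<epsilon>) + 1) *
      (Gamma_q q (2 * (m + \<epsilon>) + 2 * (n + \<epsilon>) - real r - real i + 3) * \<epsilon> ^ p (c1 i)) /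
      ((Gamma_q q (2 * (n + \<epsilon>) - real i + 2) * \<epsilon> ^ p (c2 i)) *
       (Gamma_q q (2 * (m + \<epsilon>) - real i + 2) * \<epsilon> ^ p (c3 i)) *
        (Gamma_q q (m + \<epsilon> + (n + \<epsilon>) - real i + 2) * \<epsilon> ^ p (c4 i))\<^sup>2))"
      by (rule ext) (simp add: U_def T_def power_add power_mult_distrib mult_ac flip: power_mult)
    moreover have "(\<dots> \<longlongrightarrow> Gamma_q q (real i) * L5 * L6 * L1 / (L2 * L3 * L4\<^sup>2)) (at 0)"
      by (intro tendsto_intros L1 L2 L3 L4 L5 L6) (use L2 L3 L4 in auto)
    ultimately show ?thesis by auto
  qed
  then obtain L where L: "(U i \<longlongrightarrow> L i) (at 0)" for i by metis
  define A where "A = (\<Sum>i=1..r. p (c1 i))"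
  define B where "B = (\<Sum>i=1..r. p (c2 i) + p (c3 i) + 2 * p (c4 i))"
  have AB: "A < B"
  proof -
    have count: "(\<Sum>i=1..r. p (int a - int i)) = r + 1 - a" if "1 \<le> a" for a
    proof -
      have "(\<Sum>i=1..r. p (int a - int i)) = (\<Sum>i\<in>{a..r}. 1)"
        by (rule sum.mono_neutral_cong_right) (use that in \<open>auto simp: p_def\<close>)
      then show ?thesis by simp
    qed
    \<comment> \<open>For \<open>r > 2s + 2\<close> every \<open>i\<close> gives a pole; the maximum keeps the threshold in the range
      \<open>1..r\<close>.\<close>
    have "A \<le> (\<Sum>i=1..r. p (int (nat (max 1 (2 * int s + 3 - int r))) - int i))"
      unfolding A_def by (intro sum_mono) (auto simp: p_def c1_def)
    also have "\<dots> \<le> 2 * (r - s - 1)" by (subst count) (use big in auto)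
    finally have A: "A \<le> 2 * (r - s - 1)" .
    have "(\<Sum>i=1..r. p (c4 i)) = r - s - 1"
      using count[of "s + 2"] big by (simp add: c4_def algebra_simps)
    moreover have "(\<Sum>i=1..r. p (c2 i)) + (\<Sum>i=1..r. p (c3 i)) > 0"
    proof -
      have "p (c2 r) + p (c3 r) > 0" using big NMs by (auto simp: p_def c2_def c3_def)
      moreover have "p (c2 r) \<le> (\<Sum>i=1..r. p (c2 i))" "p (c3 r) \<le> (\<Sum>i=1..r. p (c3 i))"
        using r by (auto intro!: member_le_sum)
      ultimately show ?thesis by linarith
    qed
    ultimately show ?thesis
      using A unfolding B_def sum.distrib sum_distrib_left[symmetric] by linarith
  qed
  define W where "W \<epsilon> = fact r * q powr (- real r * (m + \<epsilon>) * (n + \<epsilon>) -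
      real r * (real r - 1) * (2 * real r - 3 * (m + \<epsilon>) - 3 * (n + \<epsilon>) - 1) / 6)" for \<epsilon>
  have "((\<lambda>\<epsilon>. W \<epsilon> * ((\<Prod>i=1..r. U i \<epsilon>) * \<epsilon> ^ (B - A))) \<longlongrightarrow>
      W 0 * ((\<Prod>i=1..r. L i) * 0 ^ (B - A))) (at 0)"
    unfolding W_def using q by (intro tendsto_intros L) auto
  moreover have "(0::real) ^ (B - A) = 0"
    using AB by (intro zero_power) simp
  ultimately have "((\<lambda>\<epsilon>. W \<epsilon> * ((\<Prod>i=1..r. U i \<epsilon>) * \<epsilon> ^ (B - A))) \<longlongrightarrow> 0) (at 0)"
    by (simp only: mult_zero_right)
  moreover have "\<forall>\<^sub>F \<epsilon> in at 0. W \<epsilon> * ((\<Prod>i=1..r. U i \<epsilon>) * \<epsilon> ^ (B - A)) = rhs q r (m + \<epsilon>) (n + \<epsilon>)"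
  proof -
    have "\<forall>\<^sub>F \<epsilon> in at 0. \<epsilon> \<noteq> (0::real)" by (simp add: eventually_at_filter)
    then show ?thesis
    proof eventually_elim
      case (elim \<epsilon>)
      have "(\<Prod>i=1..r. U i \<epsilon>) = (\<Prod>i=1..r. T i \<epsilon>) * \<epsilon> ^ A / \<epsilon> ^ B"
        unfolding U_def prod_dividef prod.distrib A_def B_def power_sum ..
      moreover have "\<epsilon> ^ B = \<epsilon> ^ A * \<epsilon> ^ (B - A)" using AB by (simp flip: power_add)
      ultimately have "(\<Prod>i=1..r. U i \<epsilon>) * \<epsilon> ^ (B - A) = (\<Prod>i=1..r. T i \<epsilon>)"
        using elim by simp
      then show ?case unfolding rhs_def W_def T_def by (simp only:)
    qed
  qed
  ultimately show ?thesis by (rule Lim_transform_eventually)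
qed

end

theorem proposition7p1:
  fixes q m n :: real and r :: nat
  assumes "0 < q" and "q < 1" and "r \<ge> 1"
    and "(m \<in> \<nat> \<and> n \<in> \<nat>) \<or> (m - 1 / 2 \<in> \<nat> \<and> n - 1 / 2 \<in> \<nat>)"
  defines "S \<equiv>
    (\<Sum>k\<in>{1..r} \<rightarrow>\<^sub>E sum_range n.
       (\<Prod>(i, j)\<in>{(i, j). 1 \<le> i \<and> i < j \<and> j \<le> r}. (qnumber q (k j - k i))\<^sup>2)
       * (\<Prod>i=1..r. q powr ((k i)\<^sup>2 + (m + n - 2 * real i + 2) * k i)
            * qbinomial q \<lfloor>2 * n\<rfloor> \<lfloor>n + k i\<rfloor>
            * qbinomial q \<lfloor>2 * m\<rfloor> \<lfloor>m + k i\<rfloor>))"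
  shows "if rhs_has_pole r m n
         then ((\<lambda>\<epsilon>. rhs q r (m + \<epsilon>) (n + \<epsilon>)) \<longlongrightarrow> S) (at 0)
         else S = rhs q r m n"
proof -
  have "\<exists>N M s. 2 * n = real N \<and> 2 * m = real M \<and> m + n = real s"
  proof (cases "m \<in> \<nat> \<and> n \<in> \<nat>")
    case True
    then obtain a b where "m = real a" "n = real b" by (auto elim!: Nats_cases)
    then show ?thesis by (intro exI[of _ "2 * b"] exI[of _ "2 * a"] exI[of _ "a + b"]) simp
  next
    case False
    with assms(4) obtain a b where "m - 1 / 2 = real a" "n - 1 / 2 = real b"
      by (auto elim!: Nats_cases)
    then have "m = real a + 1 / 2" "n = real b + 1 / 2" by simp_all
    then show ?thesis
      by (intro exI[of _ "2 * b + 1"] exI[of _ "2 * a + 1"] exI[of _ "a + b + 1"]) simp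
  qed
  then obtain N M s where NMs: "2 * n = real N" "2 * m = real M" "m + n = real s" by blast
  note params = assms(1-3) NMs
  have S: "S = (\<Sum>k\<in>{1..r} \<rightarrow>\<^sub>E sum_range n. summand q r m n k)"
    unfolding S_def summand_def ..
  have S0: "S = 0" if "N + 1 < r \<or> M + 1 < r"
    unfolding S by (rule sum.neutral) (use summand_eq_0[OF params that] in blast)
  show ?thesis
  proof (cases "rhs_has_pole r m n")
    case True
    then have "s + 2 \<le> r" by (rule rhs_has_pole_imp[OF params])
    moreover have "N + M = 2 * s" using NMs by linarith
    ultimately have "S = 0" by (intro S0) linarith
    with True rhs_tendsto_0[OF params \<open>s + 2 \<le> r\<close>] show ?thesis by simp
  next
    case False
    have "S = rhs q r m n"
    proof (cases "N + 1 < r \<or> M + 1 < r")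
      case True
      then show ?thesis using S0 rhs_eq_0[OF params] by simp
    next
      case False
      then show ?thesis unfolding S by (intro sum_summand_eq_rhs[OF params]) auto
    qed
    with False show ?thesis by simp
  qed
qed

end
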